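(* Let $\mathbb{C}\mathrm{H}(n)=G/H$ with $G=F_rN$ be a non-symmetric homogeneous description, $\mathfrak{g}=\mathfrak{h}+\mathfrak{m}$ a reductive decomposition, and $\tilde\nabla$ its canonical connection. Then the homogeneous structure tensor $S=\nabla-\tilde\nabla$ ($\nabla$ the Levi-Civita connection), evaluated at the base point on $\mathfrak{m}\cong T_o\mathbb{C}\mathrm{H}(n)$, is given for all $B,C,D\in\mathfrak{m}$ by $$g(S_BC,D)=\alpha_D\,g(B,C)-\alpha_C\,g(B,D)+\alpha_{JD}\,g(B,JC)-\alpha_{JC}\,g(B,JD)-\alpha_{JB}\,\omega(\tilde X_C,\tilde X_D)+g([B',C],D)+\alpha_B\,g(C_r,D).$$
   Context: Fix $n\ge1$ and $\mu>0$. $\mathrm{SU}(n,1)$ is the group of determinant-one complex $(n+1)\times(n+1)$ matrices preserving the Hermitian form $\hat h(X,Y)=\overline{Y_1}X_1+\dots+\overline{Y_{n-1}}X_{n-1}+\overline{Y_{n+1}}X_n+\overline{Y_n}X_{n+1}$; $\mathbb{C}\mathrm{H}(n)$ is the space of $\hat h$-negative lines, with the Kähler metric of constant holomorphic sectional curvature $-4/\mu$, and base point $o$ the line spanned by $(0,\dots,0,1,-1)$. Matrices are in blocks of sizes $n-1,1,1$. Put $\mathfrak{s}(\mathfrak{u}(n-1)+\mathfrak{u}(1))=\{\mathrm{diag}(B,ic,ic): B\in\mathfrak{u}(n-1),c\in\mathbb{R},\mathrm{tr}B+2ic=0\}$, with connected group $\mathrm{S}(\mathrm{U}(n-1)\mathrm{U}(1))$;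 $A_0=\mathrm{diag}(0,\dots,0,1,-1)$, $\mathfrak{a}=\mathbb{R}A_0$, $A=\exp\mathfrak{a}$; $\mathfrak{n}_1=\left\{\begin{pmatrix}0&0&v\\-v^*&0&0\\0&0&0\end{pmatrix}: v\in\mathbb{C}^{n-1}\right\}\cong\mathbb{C}^{n-1}$; $N_2=\begin{pmatrix}0&0&0\\0&0&i\\0&0&0\end{pmatrix}$, $\mathfrak{n}_2=\mathbb{R}N_2$, $\mathfrak{n}=\mathfrak{n}_1+\mathfrak{n}_2$, $N=\exp\mathfrak{n}$. Non-symmetric description: $G=F_rN$, where $F_r$ is a connected closed subgroup of $\mathrm{S}(\mathrm{U}(n-1)\mathrm{U}(1))A$ with non-trivial projection to $A$, and $H=F_r\cap \mathrm{S}(\mathrm{U}(n-1)\mathrm{U}(1))$; $\mathfrak{g},\mathfrak{h},\mathfrak{f}_r$ are the Lie algebras of $G,H,F_r$. Let $\mathfrak{a}_r$ be the orthogonal complement of $\mathfrak{h}$ in $\mathfrak{f}_r$ for $k(E,E')=\mathrm{Re}\,\mathrm{tr}(E^*E')$; it is one-dimensional, $\mathfrak{a}_r=\mathbb{R}A_r$ with $A_r=A_0+H_r$, $H_r\in\mathfrak{s}(\mathfrak{u}(n-1)+\mathfrak{u}(1))$. Put $\mathfrak{s}=\mathfrak{a}+\mathfrak{n}$, $\mathfrak{s}_r=\mathfrak{a}_r+\mathfrak{n}$, and let $\chi_r:\mathfrak{s}\to\mathfrak{s}_r$ be linear, the identity on $\mathfrak{n}$, with $\chi_r(A_0)=A_r$.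 Given a reductive decomposition $\mathfrak{g}=\mathfrak{h}+\mathfrak{m}$ ($\mathfrak{m}$ an $\mathrm{Ad}(H)$-invariant complement), $\mathfrak{m}$ is the graph of a unique $\mathfrak{h}$-equivariant linear map $\varphi_r:\mathfrak{s}_r\to\mathfrak{h}$; put $\varphi=\varphi_r\circ\chi_r:\mathfrak{s}\to\mathfrak{h}$ and $\tilde X=\chi_r(X)+\varphi(X)$, so $X\mapsto\tilde X$ is a linear isomorphism $\mathfrak{s}\to\mathfrak{m}$. Every $B\in\mathfrak{m}$ is written uniquely $B=\alpha_B\tilde A_0+\eta_B\tilde N_2+\tilde X_B$ with $\alpha_B,\eta_B\in\mathbb{R}$ and $X_B\in\mathfrak{n}_1$, corresponding to $v_B\in\mathbb{C}^{n-1}$. Under $\mathfrak{m}\cong T_o\mathbb{C}\mathrm{H}(n)$ the metric and Kähler form are $g(B,C)=\mu(\alpha_B\alpha_C+\tfrac14\eta_B\eta_C)+\tfrac{\mu}{2}\mathrm{Re}(v_C^*v_B)$ and $\omega(B,C)=\tfrac{\mu}{2}(\alpha_B\eta_C-\eta_B\alpha_C)+\tfrac{\mu}{2}\mathrm{Im}(v_C^*v_B)$, and $J$ is defined by $\omega(B,C)=g(B,JC)$; so $J\tilde A_0=-2\tilde N_2$, $J\tilde N_2=\tfrac12\tilde A_0$, and $J$ acts on $\tilde{\mathfrak n}_1\cong\mathbb{C}^{n-1}$ as multiplication by $i$. Put $B'=\alpha_B\varphi(A_0)+\eta_B\varphi(N_2)+\varphi(X_B)\in\mathfrak{h}$ and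 $B_r=\widetilde{[H_r,X_B]}\in\mathfrak{m}$. The canonical connection satisfies $\tilde\nabla_BC=-[B,C]_{\mathfrak{m}}$ at $o$ for $B,C\in\mathfrak{m}$, where in the covariant derivative $B,C$ stand for the infinitesimal generators on $\mathbb{C}\mathrm{H}(n)$ of the corresponding elements of $\mathfrak m$. *)

theory Defs
  imports "HOL-Analysis.Analysis"
begin

section \<open>Matrix groups and their Lie algebras\<close>

definition mexp :: "complex^'k^'k \<Rightarrow> complex^'k^'k" where
  "mexp A = (\<Sum>k. (1 / fact k) *\<^sub>R (((**) A ^^ k) (mat 1)))"

definition conj_transpose :: "complex^'k^'k \<Rightarrow> complex^'k^'k" where
  "conj_transpose E = (\<chi> i j. cnj (E $ j $ i))"

definition comm :: "complex^'k^'k \<Rightarrow> complex^'k^'k \<Rightarrow> complex^'k^'k" where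
  "comm X Y = X ** Y - Y ** X"

definition matrix_group :: "(complex^'k^'k) set \<Rightarrow> bool" where
  "matrix_group K \<longleftrightarrow> mat 1 \<in> K \<and> (\<forall>a\<in>K. \<forall>b\<in>K. a ** b \<in> K) \<and>
     (\<forall>a\<in>K. invertible a \<and> matrix_inv a \<in> K)"

definition group_span :: "(complex^'k^'k) set \<Rightarrow> (complex^'k^'k) set" where
  "group_span S = \<Inter>{K. matrix_group K \<and> S \<subseteq> K}"

text \<open>The Lie algebra of a closed group of matrices.\<close>

definition lie_algebra :: "(complex^'k^'k) set \<Rightarrow> (complex^'k^'k) set" where
  "lie_algebra K = {X. \<forall>t::real. mexp (t *\<^sub>R X) \<in> K}"

text \<open>Reductive decomposition \<open>\<gg> = \<hh> \<oplus> \<mm>\<close> of the Lie algebra of \<open>G\<close>, where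
  \<open>\<hh>\<close> is the Lie algebra of the subgroup \<open>H\<close>.\<close>

definition reductive_decomposition ::
  "(complex^'k^'k) set \<Rightarrow> (complex^'k^'k) set \<Rightarrow> (complex^'k^'k) set \<Rightarrow> bool" where
  "reductive_decomposition G H \<mm> \<longleftrightarrow>
     subspace (lie_algebra H) \<and> subspace \<mm> \<and> lie_algebra H \<inter> \<mm> = {0} \<and>
     lie_algebra G = {X + Y | X Y. X \<in> lie_algebra H \<and> Y \<in> \<mm>} \<and>
     (\<forall>a\<in>H. \<forall>X\<in>\<mm>. a ** X ** matrix_inv a \<in> \<mm>)"

definition m_part ::
  "(complex^'k^'k) set \<Rightarrow> (complex^'k^'k) set \<Rightarrow> complex^'k^'k \<Rightarrow> complex^'k^'k" where
  "m_part \<hh> \<mm> X = (THE Y. Y \<in> \<mm> \<and> X - Y \<in> \<hh>)"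

definition linear_from :: "'a::real_vector set \<Rightarrow> ('a \<Rightarrow> 'b::real_vector) \<Rightarrow> bool" where
  "linear_from V f \<longleftrightarrow> (\<forall>x\<in>V. \<forall>y\<in>V. f (x + y) = f x + f y) \<and>
     (\<forall>c. \<forall>x\<in>V. f (c *\<^sub>R x) = c *\<^sub>R f x)"


section \<open>Affine connections on an open set\<close>

text \<open>A manifold with a global chart is an open subset \<open>U\<close> of a Euclidean space; a vector
  field on it is a map into that space, of which only the values on \<open>U\<close> matter.\<close>

primrec Ck_on :: "nat \<Rightarrow> 'a::euclidean_space set \<Rightarrow> ('a \<Rightarrow> 'b::euclidean_space) \<Rightarrow> bool" where
  "Ck_on 0 U f \<longleftrightarrow> continuous_on U f"
| "Ck_on (Suc k) U f \<longleftrightarrow> (\<forall>x\<in>U. f differentiable (at x)) \<and>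
     (\<forall>v. Ck_on k U (\<lambda>x. frechet_derivative f (at x) v))"

definition smooth_on :: "'a::euclidean_space set \<Rightarrow> ('a \<Rightarrow> 'b::euclidean_space) \<Rightarrow> bool" where
  "smooth_on U f \<longleftrightarrow> (\<forall>k. Ck_on k U f)"

definition dir_deriv :: "('a \<Rightarrow> 'a) \<Rightarrow> ('a::euclidean_space \<Rightarrow> 'b::euclidean_space) \<Rightarrow> 'a \<Rightarrow> 'b" where
  "dir_deriv X f z = frechet_derivative f (at z) (X z)"

definition affine_connection ::
  "'a::euclidean_space set \<Rightarrow> (('a \<Rightarrow> 'a) \<Rightarrow> ('a \<Rightarrow> 'a) \<Rightarrow> 'a \<Rightarrow> 'a) \<Rightarrow> bool" where
  "affine_connection U D \<longleftrightarrow>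
     (\<forall>X Y. smooth_on U X \<longrightarrow> smooth_on U Y \<longrightarrow> smooth_on U (D X Y)) \<and>
     (\<forall>X X' Y. smooth_on U X \<longrightarrow> smooth_on U X' \<longrightarrow> smooth_on U Y \<longrightarrow>
        (\<forall>z\<in>U. D (\<lambda>x. X x + X' x) Y z = D X Y z + D X' Y z)) \<and>
     (\<forall>f X Y. smooth_on U f \<longrightarrow> smooth_on U X \<longrightarrow> smooth_on U Y \<longrightarrow>
        (\<forall>z\<in>U. D (\<lambda>x. f x *\<^sub>R X x) Y z = f z *\<^sub>R D X Y z)) \<and>
     (\<forall>X Y Y'. smooth_on U X \<longrightarrow> smooth_on U Y \<longrightarrow> smooth_on U Y' \<longrightarrow>
        (\<forall>z\<in>U. D X (\<lambda>x. Y x + Y' x) z = D X Y z + D X Y' z)) \<and>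
     (\<forall>f X Y. smooth_on U f \<longrightarrow> smooth_on U X \<longrightarrow> smooth_on U Y \<longrightarrow>
        (\<forall>z\<in>U. D X (\<lambda>x. f x *\<^sub>R Y x) z = dir_deriv X f z *\<^sub>R Y z + f z *\<^sub>R D X Y z))"

definition levi_civita ::
  "'a::euclidean_space set \<Rightarrow> ('a \<Rightarrow> 'a \<Rightarrow> 'a \<Rightarrow> real) \<Rightarrow>
     (('a \<Rightarrow> 'a) \<Rightarrow> ('a \<Rightarrow> 'a) \<Rightarrow> 'a \<Rightarrow> 'a) \<Rightarrow> bool" where
  "levi_civita U g D \<longleftrightarrow> affine_connection U D \<and>
     (\<forall>X Y. smooth_on U X \<longrightarrow> smooth_on U Y \<longrightarrow>
        (\<forall>z\<in>U. D X Y z - D Y X z = dir_deriv X Y z - dir_deriv Y X z)) \<and>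
     (\<forall>X Y Z. smooth_on U X \<longrightarrow> smooth_on U Y \<longrightarrow> smooth_on U Z \<longrightarrow>
        (\<forall>z\<in>U. dir_deriv X (\<lambda>x. g x (Y x) (Z x)) z = g z (D X Y z) (Z z) + g z (Y z) (D X Z z)))"


section \<open>Complex hyperbolic space\<close>

text \<open>Let \<open>n = CARD('n)\<close>. The \<open>n + 1\<close> coordinates are indexed by \<open>'n option\<close>: a fixed \<open>p :: 'n\<close>
  gives the index \<open>Some p\<close> of the \<open>n\<close>-th coordinate, \<open>None\<close> is the index of the \<open>(n+1)\<close>-st, and
  the \<open>Some j\<close> with \<open>j \<noteq> p\<close> are the indices of the first \<open>n - 1\<close> coordinates (there are none
  if \<open>n = 1\<close>).\<close>

definition herm :: "'n::finite \<Rightarrow> complex^('n option) \<Rightarrow> complex^('n option) \<Rightarrow> complex" where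
  "herm p X Y = (\<Sum>j\<in>-{p}. cnj (Y $ Some j) * X $ Some j)
     + cnj (Y $ None) * X $ Some p + cnj (Y $ Some p) * X $ None"

text \<open>A negative line contains a unique vector with \<open>None\<close>-coordinate 1 (see
  \<open>bij_betw_CH\<close> below), so complex hyperbolic space has a global chart with values in
  \<open>\<complex>\<^sup>n\<close>, in which it is a Siegel domain.\<close>

definition lift_vec :: "complex \<Rightarrow> complex^'n::finite \<Rightarrow> complex^('n option)" where
  "lift_vec c z = (\<chi> i. case i of None \<Rightarrow> c | Some j \<Rightarrow> z $ j)"

definition cline :: "complex^'k \<Rightarrow> (complex^'k) set" where
  "cline X = range (\<lambda>c. c *s X)"

definition CH :: "'n::finite \<Rightarrow> (complex^'n) set" where
  "CH p = {z. Re (herm p (lift_vec 1 z) (lift_vec 1 z)) < 0}"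

definition base_pt :: "'n::finite \<Rightarrow> complex^'n" where
  "base_pt p = axis p (-1)"

text \<open>The \<open>SU(n,1)\<close>-invariant Kaehler metric of constant holomorphic sectional curvature
  \<open>-4/\<mu>\<close>. At the line of \<open>Z\<close> it is \<open>\<mu>\<close> times the real part of
  \<open>- h(U,W)/h(Z,Z) + h(U,Z) h(Z,W)/h(Z,Z)\<^sup>2\<close>, where \<open>U\<close>, \<open>W\<close> represent the tangent vectors;
  in the unit disc (\<open>n = 1\<close>) this is \<open>\<mu> |dw|\<^sup>2 / (1 - |w|\<^sup>2)\<^sup>2\<close>.\<close>

definition CH_metric ::
  "real \<Rightarrow> 'n::finite \<Rightarrow> complex^'n \<Rightarrow> complex^'n \<Rightarrow> complex^'n \<Rightarrow> real" where
  "CH_metric \<mu> p z u w =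
     (let Z = lift_vec 1 z; U = lift_vec 0 u; W = lift_vec 0 w; h = herm p in
      \<mu> * Re (- h U W / h Z Z + h U Z * h Z W / (h Z Z)\<^sup>2))"

definition CH_kaehler ::
  "real \<Rightarrow> 'n::finite \<Rightarrow> complex^'n \<Rightarrow> complex^'n \<Rightarrow> complex^'n \<Rightarrow> real" where
  "CH_kaehler \<mu> p z u w = CH_metric \<mu> p z u (\<i> *s w)"

definition act :: "complex^('n option)^('n option) \<Rightarrow> complex^'n::finite \<Rightarrow> complex^'n" where
  "act a z = (\<chi> j. (a *v lift_vec 1 z) $ Some j / (a *v lift_vec 1 z) $ None)"

definition gen :: "complex^('n option)^('n option) \<Rightarrow> complex^'n::finite \<Rightarrow> complex^'n" where
  "gen B z = vector_derivative (\<lambda>t. act (mexp (t *\<^sub>R B)) z) (at 0)"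

definition push_forward ::
  "complex^('n option)^('n option) \<Rightarrow> (complex^'n::finite \<Rightarrow> complex^'n) \<Rightarrow> complex^'n \<Rightarrow> complex^'n" where
  "push_forward a X z =
     (let y = act (matrix_inv a) z in frechet_derivative (act a) (at y) (X y))"

text \<open>The canonical connection of a reductive decomposition is the \<open>G\<close>-invariant connection with
  \<open>\<nabla>\<^sub>B C = -[B, C]\<^sub>\<mm>\<close> at the base point for \<open>B, C \<in> \<mm>\<close>; here elements of \<open>\<mm>\<close> stand for their
  infinitesimal generators, and \<open>\<mm>\<close> is identified with the tangent space by \<open>B \<mapsto> gen B (base_pt p)\<close>.\<close>

definition canonical_connection ::
  "'n::finite \<Rightarrow> (complex^('n option)^('n option)) set \<Rightarrow> (complex^('n option)^('n option)) set \<Rightarrow>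
   (complex^('n option)^('n option)) set \<Rightarrow>
   ((complex^'n \<Rightarrow> complex^'n) \<Rightarrow> (complex^'n \<Rightarrow> complex^'n) \<Rightarrow> complex^'n \<Rightarrow> complex^'n) \<Rightarrow> bool" where
  "canonical_connection p G H \<mm> D \<longleftrightarrow> affine_connection (CH p) D \<and>
     (\<forall>a\<in>G. \<forall>X Y. smooth_on (CH p) X \<longrightarrow> smooth_on (CH p) Y \<longrightarrow>
        (\<forall>z\<in>CH p. D (push_forward a X) (push_forward a Y) z = push_forward a (D X Y) z)) \<and>
     (\<forall>B\<in>\<mm>. \<forall>C\<in>\<mm>. D (gen B) (gen C) (base_pt p)
        = - gen (m_part (lie_algebra H) \<mm> (comm B C)) (base_pt p))"


section \<open>Non-symmetric homogeneous descriptions\<close>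

text \<open>The block diagonal matrix \<open>diag(B, b, c)\<close> with blocks of sizes \<open>n - 1, 1, 1\<close>; the row and
  the column of \<open>B\<close> with index \<open>p\<close> are ignored.\<close>

definition diag3 :: "'n::finite \<Rightarrow> complex^'n^'n \<Rightarrow> complex \<Rightarrow> complex \<Rightarrow> complex^('n option)^('n option)" where
  "diag3 p B b c = (\<chi> i j. case i of
       None \<Rightarrow> (case j of None \<Rightarrow> c | Some l \<Rightarrow> 0)
     | Some k \<Rightarrow> (case j of None \<Rightarrow> 0 | Some l \<Rightarrow>
         if k = p \<and> l = p then b else if k = p \<or> l = p then 0 else B $ k $ l))"

definition su_u1 :: "'n::finite \<Rightarrow> (complex^('n option)^('n option)) set" where
  "su_u1 p = {diag3 p B (\<i> * of_real c) (\<i> * of_real c) | B c.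
     (\<forall>k\<in>-{p}. \<forall>l\<in>-{p}. B $ k $ l = - cnj (B $ l $ k)) \<and>
     (\<Sum>k\<in>-{p}. B $ k $ k) + 2 * \<i> * of_real c = 0}"

text \<open>The connected Lie group with Lie algebra \<open>su_u1 p\<close>, generated by exponentials; for \<open>n = 1\<close> it
  is trivial, although \<open>{diag(U, z, z). det U * z\<^sup>2 = 1}\<close> has two elements.\<close>

definition SU_U1 :: "'n::finite \<Rightarrow> (complex^('n option)^('n option)) set" where
  "SU_U1 p = group_span (mexp ` su_u1 p)"

definition A0 :: "'n::finite \<Rightarrow> complex^('n option)^('n option)" where
  "A0 p = diag3 p 0 1 (-1)"

definition grpA :: "'n::finite \<Rightarrow> (complex^('n option)^('n option)) set" where
  "grpA p = range (\<lambda>t::real. mexp (t *\<^sub>R A0 p))"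

text \<open>The \<open>p\<close>-th component of \<open>v\<close> is ignored.\<close>

definition n1_mat :: "'n::finite \<Rightarrow> complex^'n \<Rightarrow> complex^('n option)^('n option)" where
  "n1_mat p v = (\<chi> i j. case i of
       None \<Rightarrow> 0
     | Some k \<Rightarrow> (case j of None \<Rightarrow> if k = p then 0 else v $ k
         | Some l \<Rightarrow> if k = p \<and> l \<noteq> p then - cnj (v $ l) else 0))"

definition nil1 :: "'n::finite \<Rightarrow> (complex^('n option)^('n option)) set" where
  "nil1 p = range (n1_mat p)"

definition N2 :: "'n::finite \<Rightarrow> complex^('n option)^('n option)" where
  "N2 p = (\<chi> i j. if i = Some p \<and> j = None then \<i> else 0)"

definition nilp :: "'n::finite \<Rightarrow> (complex^('n option)^('n option)) set" where
  "nilp p = {X + e *\<^sub>R N2 p | X e. X \<in> nil1 p}"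

definition grpN :: "'n::finite \<Rightarrow> (complex^('n option)^('n option)) set" where
  "grpN p = mexp ` nilp p"

definition sol :: "'n::finite \<Rightarrow> (complex^('n option)^('n option)) set" where
  "sol p = {a *\<^sub>R A0 p + X | a X. X \<in> nilp p}"

definition nonsymmetric_Fr :: "'n::finite \<Rightarrow> (complex^('n option)^('n option)) set \<Rightarrow> bool" where
  "nonsymmetric_Fr p Fr \<longleftrightarrow>
     (let SA = {k ** a | k a. k \<in> SU_U1 p \<and> a \<in> grpA p} in
      matrix_group Fr \<and> Fr \<subseteq> SA \<and> closedin (top_of_set SA) Fr \<and> connected Fr \<and>
      (\<exists>k\<in>SU_U1 p. \<exists>a\<in>grpA p. k ** a \<in> Fr \<and> a \<noteq> mat 1))"

definition grpG :: "'n::finite \<Rightarrow> (complex^('n option)^('n option)) set \<Rightarrow> (complex^('n option)^('n option)) set" where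
  "grpG p Fr = {f ** x | f x. f \<in> Fr \<and> x \<in> grpN p}"

definition grpH :: "'n::finite \<Rightarrow> (complex^('n option)^('n option)) set \<Rightarrow> (complex^('n option)^('n option)) set" where
  "grpH p Fr = Fr \<inter> SU_U1 p"

text \<open>The orthogonal complement of \<open>\<hh>\<close> in the Lie algebra of \<open>F\<^sub>r\<close> for
  \<open>k(E, E') = Re tr(E\<^sup>* E')\<close>.\<close>

definition alg_a_r :: "'n::finite \<Rightarrow> (complex^('n option)^('n option)) set \<Rightarrow> (complex^('n option)^('n option)) set" where
  "alg_a_r p Fr = {E \<in> lie_algebra Fr. \<forall>E'\<in>lie_algebra (grpH p Fr).
     Re (trace (conj_transpose E ** E')) = 0}"

definition sol_r :: "'n::finite \<Rightarrow> (complex^('n option)^('n option)) set \<Rightarrow> (complex^('n option)^('n option)) set" where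
  "sol_r p Fr = {E + X | E X. E \<in> alg_a_r p Fr \<and> X \<in> nilp p}"

text \<open>Below, \<open>T :: \<ss> \<rightarrow> \<mm>\<close> is the isomorphism written with a tilde in the notation
  \<open>B = \<alpha>\<^sub>B T(A\<^sub>0) + \<eta>\<^sub>B T(N\<^sub>2) + T(X\<^sub>B)\<close> for \<open>B \<in> \<mm>\<close>.\<close>

definition alpha_of :: "'n::finite \<Rightarrow> (complex^('n option)^('n option) \<Rightarrow> complex^('n option)^('n option)) \<Rightarrow>
    complex^('n option)^('n option) \<Rightarrow> real" where
  "alpha_of p T B = (THE a. \<exists>e. \<exists>X\<in>nil1 p. B = a *\<^sub>R T (A0 p) + e *\<^sub>R T (N2 p) + T X)"

definition eta_of :: "'n::finite \<Rightarrow> (complex^('n option)^('n option) \<Rightarrow> complex^('n option)^('n option)) \<Rightarrow>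
    complex^('n option)^('n option) \<Rightarrow> real" where
  "eta_of p T B = (THE e. \<exists>a. \<exists>X\<in>nil1 p. B = a *\<^sub>R T (A0 p) + e *\<^sub>R T (N2 p) + T X)"

definition X_of :: "'n::finite \<Rightarrow> (complex^('n option)^('n option) \<Rightarrow> complex^('n option)^('n option)) \<Rightarrow>
    complex^('n option)^('n option) \<Rightarrow> complex^('n option)^('n option)" where
  "X_of p T B = (THE X. X \<in> nil1 p \<and> (\<exists>a e. B = a *\<^sub>R T (A0 p) + e *\<^sub>R T (N2 p) + T X))"

text \<open>The metric and the Kaehler form at the base point, carried over to matrices by
  \<open>B \<mapsto> gen B (base_pt p)\<close>. The coordinate formulas for them are \<open>g_o_formula\<close> and
  \<open>omega_o_formula\<close> below.\<close>

definition g_o :: "real \<Rightarrow> 'n::finite \<Rightarrow> complex^('n option)^('n option) \<Rightarrow> complex^('n option)^('n option) \<Rightarrow> real" where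
  "g_o \<mu> p B C = CH_metric \<mu> p (base_pt p) (gen B (base_pt p)) (gen C (base_pt p))"

definition omega_o :: "real \<Rightarrow> 'n::finite \<Rightarrow> complex^('n option)^('n option) \<Rightarrow> complex^('n option)^('n option) \<Rightarrow> real" where
  "omega_o \<mu> p B C = CH_kaehler \<mu> p (base_pt p) (gen B (base_pt p)) (gen C (base_pt p))"

definition J_o :: "real \<Rightarrow> 'n::finite \<Rightarrow> (complex^('n option)^('n option)) set \<Rightarrow>
    complex^('n option)^('n option) \<Rightarrow> complex^('n option)^('n option)" where
  "J_o \<mu> p \<mm> C = (THE E. E \<in> \<mm> \<and> (\<forall>B\<in>\<mm>. omega_o \<mu> p B C = g_o \<mu> p B E))"


section \<open>Consistency of the model\<close>

lemma norm_matpow_nth: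
  fixes A :: "complex^'k^'k"
  shows "norm ((((**) A ^^ k) (mat 1)) $ i $ j) \<le> (CARD('k) * norm A) ^ k"
proof (induction k arbitrary: i j)
  case 0
  then show ?case by (simp add: mat_def)
next
  case (Suc k)
  have "norm (A $ i $ l) \<le> norm A" for l
    by (meson Finite_Cartesian_Product.norm_nth_le order_trans)
  then have "norm (\<Sum>l\<in>UNIV. A $ i $ l * ((((**) A ^^ k) (mat 1)) $ l $ j))
      \<le> (\<Sum>l\<in>(UNIV::'k set). norm A * (CARD('k) * norm A) ^ k)"
    by (intro sum_norm_le) (simp add: norm_mult mult_mono Suc)
  moreover have "(((**) A ^^ Suc k) (mat 1)) $ i $ j = (\<Sum>l\<in>UNIV. A $ i $ l * ((((**) A ^^ k) (mat 1)) $ l $ j))"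
    by (simp add: matrix_matrix_mult_def[of A "((**) A ^^ k) (mat 1)"])
  ultimately show ?case by simp
qed

lemma mexp_entry_sums:
  fixes A :: "complex^'k^'k"
  shows "(\<lambda>k. ((((**) A ^^ k) (mat 1)) $ i $ j / fact k) * of_real t ^ k) sums (mexp (t *\<^sub>R A) $ i $ j)"
proof -
  define P where "P k = ((**) A ^^ k) (mat 1)" for k
  have pw: "((**) (t *\<^sub>R A) ^^ k) (mat 1) = (t ^ k) *\<^sub>R P k" for k
  proof (induction k)
    case (Suc k)
    have "(t *\<^sub>R A) ** (t ^ k *\<^sub>R P k) = t ^ Suc k *\<^sub>R (A ** P k)"
      by (simp add: vec_eq_iff matrix_matrix_mult_def scaleR_sum_right mult.commute)
    then show ?case using Suc by (simp add: P_def)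
  qed (simp add: P_def)
  have sm: "summable (\<lambda>k. (P k $ i $ j / fact k) * of_real t ^ k)" for i j
  proof (rule summable_comparison_test)
    show "summable (\<lambda>k. inverse (fact k) * (CARD('k) * norm A * \<bar>t\<bar>) ^ k :: real)"
      by (rule summable_exp)
    show "\<exists>N. \<forall>n\<ge>N. norm (P n $ i $ j / fact n * of_real t ^ n) \<le> inverse (fact n) * (real CARD('k) * norm A * \<bar>t\<bar>) ^ n"
      using norm_matpow_nth[of _ A i j]
      by (auto simp: norm_mult norm_divide norm_power P_def power_mult_distrib divide_simps mult_right_mono intro!: exI[of _ 0])
  qed
  define S where "S = (\<chi> i j. \<Sum>k. (P k $ i $ j / fact k) * of_real t ^ k)"
  have "(\<lambda>k. (1 / fact k) *\<^sub>R ((t ^ k) *\<^sub>R P k)) sums S"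
    unfolding sums_def
  proof (intro vec_tendstoI)
    fix i j
    have "(\<lambda>k. (P k $ i $ j / fact k) * of_real t ^ k) sums (S $ i $ j)"
      unfolding S_def using sm[of i j] by (simp add: summable_sums)
    then show "(\<lambda>n. (\<Sum>k<n. (1 / fact k) *\<^sub>R t ^ k *\<^sub>R P k) $ i $ j) \<longlonglongrightarrow> S $ i $ j"
      by (simp add: sums_def scaleR_conv_of_real[where 'a=complex] mult_ac)
  qed
  then have "mexp (t *\<^sub>R A) = S" unfolding mexp_def pw by (rule sums_unique[symmetric])
  then show ?thesis unfolding S_def using sm[of i j] by (simp add: summable_sums P_def)
qed

lemma mexp_entry_deriv:
  fixes A :: "complex^'k^'k"
  shows "((\<lambda>t. mexp (t *\<^sub>R A) $ i $ j) has_vector_derivative A $ i $ j) (at 0)"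
proof -
  define c where "c k = (((**) A ^^ k) (mat 1)) $ i $ j / fact k" for k
  have s: "(\<lambda>k. c k * of_real t ^ k) sums (mexp (t *\<^sub>R A) $ i $ j)" for t
    unfolding c_def by (rule mexp_entry_sums)
  have "summable (\<lambda>k. c k * y ^ k)" for y
  proof (rule summable_comparison_test)
    show "summable (\<lambda>k. inverse (fact k) * (CARD('k) * norm A * norm y) ^ k :: real)"
      by (rule summable_exp)
    show "\<exists>N. \<forall>n\<ge>N. norm (c n * y ^ n) \<le> inverse (fact n) * (real CARD('k) * norm A * norm y) ^ n"
      using norm_matpow_nth[of _ A i j]
      by (auto simp: c_def norm_mult norm_divide norm_power power_mult_distrib divide_simps mult_right_mono intro!: exI[of _ 0])
  qed
  then have "((\<lambda>x. \<Sum>k. c k * x ^ k) has_field_derivative (\<Sum>k. diffs c k * 0 ^ k)) (at (of_real 0))"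
    using termdiffs_strong_converges_everywhere[of c 0] by simp
  then have "((\<lambda>t. \<Sum>k. c k * of_real t ^ k) has_vector_derivative (\<Sum>k. diffs c k * 0 ^ k)) (at 0)"
    using has_vector_derivative_real_field by fastforce
  moreover have "(\<Sum>k. diffs c k * 0 ^ k) = A $ i $ j"
    by (simp add: diffs_def c_def)
  moreover have "(\<lambda>t. \<Sum>k. c k * of_real t ^ k) = (\<lambda>t. mexp (t *\<^sub>R A) $ i $ j)"
    by (rule ext, rule sums_unique[OF s, symmetric])
  ultimately show ?thesis by simp
qed

lemma mexp_zero: "mexp (0 :: complex^'k^'k) = mat 1"
proof -
  have "mexp (0 *\<^sub>R (0 :: complex^'k^'k)) $ i $ j = mat 1 $ i $ j" for i j :: 'k
    using sums_unique2[OF mexp_entry_sums[of "0::complex^'k^'k" i j 0]]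
      powser_sums_zero[of "\<lambda>k. (((**) (0::complex^'k^'k) ^^ k) (mat 1)) $ i $ j / fact k"] by simp
  then show ?thesis by (simp add: vec_eq_iff)
qed

lemma gen_formula:
  "gen B z = (\<chi> j. (B *v lift_vec 1 z) $ Some j - (B *v lift_vec 1 z) $ None * z $ j)"
proof -
  let ?Z = "lift_vec 1 z"
  have d: "((\<lambda>t. (mexp (t *\<^sub>R B) *v ?Z) $ i) has_vector_derivative (B *v ?Z) $ i) (at 0)" for i
    unfolding matrix_vector_mult_def
    by (auto intro!: has_vector_derivative_sum has_vector_derivative_mult_left mexp_entry_deriv)
  have v: "(mexp (0 *\<^sub>R B) *v ?Z) $ i = ?Z $ i" for i by (simp add: mexp_zero)
  have "((\<lambda>t. act (mexp (t *\<^sub>R B)) z $ j) has_vector_derivative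
      (B *v ?Z) $ Some j - (B *v ?Z) $ None * z $ j) (at 0)" for j
  proof -
    have "((\<lambda>t. (mexp (t *\<^sub>R B) *v ?Z) $ Some j / (mexp (t *\<^sub>R B) *v ?Z) $ None) has_derivative
       (\<lambda>h. h *\<^sub>R ((B *v ?Z) $ Some j - (B *v ?Z) $ None * z $ j))) (at 0)"
      by (rule derivative_eq_intros d[unfolded has_vector_derivative_def] refl | simp add: v)+
         (auto simp: v lift_vec_def fun_eq_iff mexp_zero algebra_simps)
    then show ?thesis by (simp add: act_def has_vector_derivative_def)
  qed
  then have "((\<lambda>t. act (mexp (t *\<^sub>R B)) z) has_vector_derivative
      (\<chi> j. (B *v ?Z) $ Some j - (B *v ?Z) $ None * z $ j)) (at 0)"
    unfolding has_vector_derivative_def has_derivative_def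
    by (auto intro!: vec_tendstoI bounded_linear_scaleR_left)
  then show ?thesis unfolding gen_def by (rule vector_derivative_at)
qed

lemma gen_base_pt:
  fixes p :: "'n::finite"
  assumes "E \<in> su_u1 p"
  shows "gen (E + a *\<^sub>R A0 p + e *\<^sub>R N2 p + n1_mat p v) (base_pt p)
    = (\<chi> j. if j = p then \<i> * of_real e - of_real (2 * a) else v $ j)"
proof -
  obtain F c where E: "E = diag3 p F (\<i> * of_real c) (\<i> * of_real c)"
    using assms by (auto simp: su_u1_def)
  have l: "lift_vec 1 (base_pt p) = (\<chi> i. if i = None then 1 else if i = Some p then -1 else 0)"
    by (auto simp: vec_eq_iff lift_vec_def base_pt_def axis_def split: option.splits)
  have mv: "(M *v lift_vec 1 (base_pt p)) $ i = M $ i $ None - M $ i $ Some p" for M :: "complex^('n option)^('n option)" and i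
  proof -
    have "(M *v lift_vec 1 (base_pt p)) $ i = (\<Sum>j\<in>UNIV. (if j = None then M $ i $ j else 0) - (if j = Some p then M $ i $ j else 0))"
      unfolding l matrix_vector_mult_def by (auto intro!: sum.cong)
    then show ?thesis by (simp add: sum_subtractf)
  qed
  show ?thesis
    unfolding gen_formula mv
    by (auto simp: vec_eq_iff E diag3_def A0_def N2_def n1_mat_def base_pt_def axis_def)
      (auto simp: scaleR_conv_of_real[where 'a=complex])
qed

lemma CH_metric_base_pt:
  fixes p :: "'n::finite"
  shows "CH_metric \<mu> p (base_pt p) (\<chi> j. if j = p then x else v $ j) (\<chi> j. if j = p then x' else v' $ j)
    = \<mu> * (Re (\<Sum>k\<in>-{p}. cnj (v' $ k) * v $ k) / 2 + Re (x * cnj x') / 4)"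
proof -
  let ?Z = "lift_vec 1 (base_pt p)"
  let ?L = "\<lambda>x v. lift_vec 0 (\<chi> j. if j = p then x else v $ j)"
  have b: "base_pt p $ j = 0" if "j \<noteq> p" for j using that by (simp add: base_pt_def axis_def)
  have b': "base_pt p $ p = -1" by (simp add: base_pt_def)
  have 1: "herm p ?Z ?Z = -2" by (simp add: herm_def lift_vec_def b b')
  have 2: "herm p (?L x v) ?Z = x" for x v by (simp add: herm_def lift_vec_def b b')
  have 3: "herm p ?Z (?L x v) = cnj x" for x v by (simp add: herm_def lift_vec_def b b')
  have 4: "herm p (?L x v) (?L x' v') = (\<Sum>k\<in>-{p}. cnj (v' $ k) * v $ k)"
    by (simp add: herm_def lift_vec_def)
  show ?thesis unfolding CH_metric_def Let_def 1 2 3 4 by simp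
qed

text \<open>For \<open>B = E + a A\<^sub>0 + e N\<^sub>2 + X\<close> with \<open>E \<in> \<ss>(\<uu>(n-1) + \<uu>(1))\<close> and \<open>X \<in> \<nn>\<^sub>1\<close> given by
  \<open>v\<close>, the metric and the Kaehler form at the base point have the following coordinate formulas.\<close>

lemma g_o_formula:
  assumes "E \<in> su_u1 p" "E' \<in> su_u1 p"
  shows "g_o \<mu> p (E + a *\<^sub>R A0 p + e *\<^sub>R N2 p + n1_mat p v) (E' + a' *\<^sub>R A0 p + e' *\<^sub>R N2 p + n1_mat p v')
      = \<mu> * (a * a' + e * e' / 4) + \<mu> / 2 * Re (\<Sum>k\<in>-{p}. cnj (v' $ k) * v $ k)"
  unfolding g_o_def gen_base_pt[OF assms(1)] gen_base_pt[OF assms(2)] CH_metric_base_pt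
  by (simp add: field_simps)

lemma omega_o_formula:
  assumes "E \<in> su_u1 p" "E' \<in> su_u1 p"
  shows "omega_o \<mu> p (E + a *\<^sub>R A0 p + e *\<^sub>R N2 p + n1_mat p v) (E' + a' *\<^sub>R A0 p + e' *\<^sub>R N2 p + n1_mat p v')
      = \<mu> / 2 * (a * e' - e * a') + \<mu> / 2 * Im (\<Sum>k\<in>-{p}. cnj (v' $ k) * v $ k)"
proof -
  have i: "\<i> *s (\<chi> j. if j = p then x else v $ j) = (\<chi> j. if j = p then \<i> * x else (\<i> *s v) $ j)" for x v
    by (simp add: vec_eq_iff)
  have s: "(\<Sum>k\<in>-{p}. cnj ((\<i> *s v') $ k) * v $ k) = - \<i> * (\<Sum>k\<in>-{p}. cnj (v' $ k) * v $ k)"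
    by (simp add: sum_distrib_left sum_negf mult_ac)
  show ?thesis
    unfolding omega_o_def CH_kaehler_def gen_base_pt[OF assms(1)] gen_base_pt[OF assms(2)] i
      CH_metric_base_pt s
    by (simp add: field_simps)
qed

lemma bij_betw_CH:
  "bij_betw (\<lambda>z. cline (lift_vec 1 z)) (CH p) {cline X | X. Re (herm p X X) < 0}"
proof -
  have inj: "inj (\<lambda>z :: complex^'n. cline (lift_vec 1 z))"
  proof (rule injI)
    fix z w :: "complex^'n"
    assume "cline (lift_vec 1 z) = cline (lift_vec 1 w)"
    moreover have "lift_vec 1 z \<in> cline (lift_vec 1 z)"
      unfolding cline_def by (rule image_eqI[of _ _ 1]) auto
    ultimately obtain c where c: "lift_vec 1 z = c *s lift_vec 1 w"
      unfolding cline_def by auto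
    from arg_cong[OF this, of "\<lambda>x. x $ None"] have "c = 1" by (simp add: lift_vec_def)
    with c have "lift_vec 1 z $ Some j = lift_vec 1 w $ Some j" for j by simp
    then show "z = w" by (simp add: lift_vec_def vec_eq_iff)
  qed
  have "\<exists>z\<in>CH p. cline X = cline (lift_vec 1 z)" if X: "Re (herm p X X) < 0" for X
  proof -
    define c where "c = X $ None"
    have c0: "c \<noteq> 0"
    proof
      assume "c = 0"
      then have "Re (herm p X X) = (\<Sum>j\<in>-{p}. (norm (X $ Some j))\<^sup>2)"
        by (simp add: herm_def c_def cmod_power2) (simp add: power2_eq_square)
      then show False using X by (simp add: sum_nonneg leD)
    qed
    define z where "z = (\<chi> j. X $ Some j / c)"
    have Xz: "X = c *s lift_vec 1 z"
      using c0 by (auto simp: vec_eq_iff lift_vec_def z_def c_def split: option.splits)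
    have "herm p X X = of_real ((norm c)\<^sup>2) * herm p (lift_vec 1 z) (lift_vec 1 z)"
      unfolding Xz complex_norm_square herm_def by (simp add: sum_distrib_left algebra_simps)
    with X have "z \<in> CH p" by (simp add: CH_def mult_less_0_iff)
    moreover have "cline X = cline (lift_vec 1 z)"
    proof -
      have "range (\<lambda>d. (d * c) *s lift_vec 1 z) = (\<lambda>d. d *s lift_vec 1 z) ` range (\<lambda>d. d * c)"
        by auto
      also have "range (\<lambda>d. d * c) = UNIV"
        using c0 by (intro surjI[of _ "\<lambda>d. d / c"]) simp
      finally show ?thesis unfolding Xz cline_def by simp
    qed
    ultimately show ?thesis by blast
  qed
  then have "(\<lambda>z. cline (lift_vec 1 z)) ` CH p = {cline X | X. Re (herm p X X) < 0}"
    unfolding CH_def by fast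
  then show ?thesis using inj_on_subset[OF inj subset_UNIV] by (simp add: bij_betw_def)
qed

lemma cline_base_pt:
  "cline (lift_vec 1 (base_pt p)) = cline (axis (Some p) 1 - axis None 1)"
proof -
  define X :: "complex^('a option)" where "X = axis (Some p) 1 - axis None 1"
  have l: "lift_vec 1 (base_pt p) = (-1) *s X"
    by (auto simp: X_def vec_eq_iff lift_vec_def base_pt_def axis_def split: option.splits)
  have "c *s X = (- c) *s ((-1) *s X)" "c *s ((-1) *s X) = (- c) *s X" for c
    by (simp_all only: vector_smult_assoc mult_minus_left mult_minus_right mult_1_right minus_minus)
  then have "range (\<lambda>c. c *s ((-1) *s X)) = range (\<lambda>c. c *s X)"
    by (intro equalityI image_subsetI) (metis rangeI)+
  then show ?thesis by (simp only: cline_def l X_def[symmetric])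
qed

end

theory Submission
  imports Defs
begin

text \<open>
  The difference of two connections is tensorial, so only the Christoffel symbols at the base point
  \<open>o\<close> matter. In the Siegel chart those of \<open>\<nabla>\<close> are \<open>\<Gamma>(u, v) = (u\<^sub>p v + v\<^sub>p u) / 2\<close>: this symmetric map is compatible
  with the first derivatives of the metric at \<open>o\<close>, and Koszul's argument makes such a map unique.
  Since fundamental vector fields satisfy \<open>[B, C]\<^sup>* = dB\<^sup>*(C\<^sup>*) - dC\<^sup>*(B\<^sup>*)\<close> and \<open>\<hh>\<close> generates fields vanishing
  at \<open>o\<close>, the normalisation of the canonical connection gives it the Christoffel symbols
  \<open>- dB\<^sup>*(C\<^sup>*)\<close>. Hence \<open>S\<^sub>B C = \<Gamma>(B\<^sup>*, C\<^sup>*) + dB\<^sup>*(C\<^sup>*)\<close> at \<open>o\<close>, which is computed by splitting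
  \<open>B\<close> into its part in \<open>\<aa> + \<nn>\<close>, \<open>\<alpha>\<^sub>B H\<^sub>r\<close> and \<open>B'\<close>.
\<close>

text \<open>The normalisation of the canonical connection passes through \<open>m_part\<close>, a
  definite description that is meaningful only on \<gg>, and \<gg> is given merely as the set of
  matrices whose one-parameter group stays in \<open>G\<close>. So it has to be proved that [B, C]
  lies in \<gg> before the normalisation says anything about the value at \<open>o\<close>.

  The coordinates \<alpha>, \<eta>, X and the map J are definite descriptions as well. All of them
  are decided by velocities at \<open>o\<close>: the tilde map changes an element of \<aa> + \<nn>
  only by matrices whose generators vanish at \<open>o\<close>, so an element of \<mm> can be
  recovered from its velocity there, and positivity of the metric pins down J.

  The remaining terms come from the solvable part alone and amount to a polynomial identity in the
  coordinates of B, C and D.\<close>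

section \<open>Smooth maps\<close>

text \<open>Derivative formulas for sums and products are available only at points of
  \<open>U\<close>, while \<open>Ck_on\<close> speaks of functions on the whole space. Openness of
  \<open>U\<close> lets a formula valid on \<open>U\<close> replace
  \<open>frechet_derivative\<close> at every order.\<close>

lemma Ck_on_cong:
  assumes "open U" "\<And>x. x \<in> U \<Longrightarrow> f x = g x" "Ck_on k U f"
  shows "Ck_on k U g"
  using assms(2,3)
proof (induction k arbitrary: f g)
  case 0
  then show ?case by (auto cong: continuous_on_cong)
next
  case (Suc k)
  have d: "(g has_derivative frechet_derivative f (at x)) (at x)" if "x \<in> U" for x
    using Suc.prems that assms(1)
    by (intro has_derivative_transform_within_open[of f _ x UNIV U g]) (auto simp: frechet_derivative_works)
  then have fd: "frechet_derivative g (at x) = frechet_derivative f (at x)" if "x \<in> U" for x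
    using that frechet_derivative_at by metis
  have "Ck_on k U (\<lambda>x. frechet_derivative g (at x) v)" for v
    by (rule Suc.IH[of "\<lambda>x. frechet_derivative f (at x) v"]) (use Suc.prems(2) fd in auto)
  then show ?case using d by (auto simp: differentiable_def)
qed

lemma Ck_on_SucD: "Ck_on (Suc k) U f \<Longrightarrow> Ck_on k U f"
proof (induction k arbitrary: f)
  case 0
  then show ?case
    by (auto intro!: continuous_at_imp_continuous_on differentiable_imp_continuous_within)
next
  case (Suc k)
  then show ?case by auto
qed

lemma Ck_on_const: "Ck_on k U (\<lambda>x. c)"
  by (induction k arbitrary: c) auto

lemma Ck_on_bounded_linear:
  assumes "bounded_linear L" "open U" "Ck_on k U f"
  shows "Ck_on k U (\<lambda>x. L (f x))"
  using assms(3)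
proof (induction k arbitrary: f)
  case 0
  then show ?case using bounded_linear.continuous_on[OF assms(1)] by auto
next
  case (Suc k)
  have d: "((\<lambda>x. L (f x)) has_derivative (\<lambda>v. L (frechet_derivative f (at x) v))) (at x)" if "x \<in> U" for x
    using Suc.prems that by (intro bounded_linear.has_derivative[OF assms(1)]) (auto simp: frechet_derivative_works)
  have "Ck_on k U (\<lambda>x. frechet_derivative (\<lambda>x. L (f x)) (at x) v)" for v
    by (rule Ck_on_cong[OF assms(2), of "\<lambda>x. L (frechet_derivative f (at x) v)"])
      (use Suc fun_cong[OF frechet_derivative_at[OF d]] in auto)
  then show ?case using d by (auto simp: differentiable_def)
qed

lemma Ck_on_id:
  assumes "open U"
  shows "Ck_on k U (\<lambda>x. x)"
proof (cases k)
  case (Suc l)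
  then show ?thesis by (auto simp: frechet_derivative_ident intro: Ck_on_const)
qed auto

lemma Ck_on_add:
  assumes "open U" "Ck_on k U f" "Ck_on k U g"
  shows "Ck_on k U (\<lambda>x. f x + g x)"
  using assms(2,3)
proof (induction k arbitrary: f g)
  case 0
  then show ?case by (auto intro: continuous_on_add)
next
  case (Suc k)
  have d: "((\<lambda>x. f x + g x) has_derivative
      (\<lambda>v. frechet_derivative f (at x) v + frechet_derivative g (at x) v)) (at x)" if "x \<in> U" for x
    using Suc.prems that by (intro has_derivative_add) (auto simp: frechet_derivative_works)
  have "Ck_on k U (\<lambda>x. frechet_derivative (\<lambda>x. f x + g x) (at x) v)" for v
    by (rule Ck_on_cong[OF assms(1), of "\<lambda>x. frechet_derivative f (at x) v + frechet_derivative g (at x) v"])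
      (use Suc fun_cong[OF frechet_derivative_at[OF d]] in auto)
  then show ?case using d by (auto simp: differentiable_def)
qed

lemma Ck_on_bilinear:
  assumes "bounded_bilinear b" "open U" "Ck_on k U f" "Ck_on k U g"
  shows "Ck_on k U (\<lambda>x. b (f x) (g x))"
  using assms(3,4)
proof (induction k arbitrary: f g)
  case 0
  then show ?case using bounded_bilinear.continuous_on[OF assms(1)] by auto
next
  case (Suc k)
  have d: "((\<lambda>x. b (f x) (g x)) has_derivative
      (\<lambda>v. b (f x) (frechet_derivative g (at x) v) + b (frechet_derivative f (at x) v) (g x))) (at x)"
    if "x \<in> U" for x
    using Suc.prems that by (intro bounded_bilinear.FDERIV[OF assms(1)]) (auto simp: frechet_derivative_works)
  \<comment> \<open>The product rule pairs a derivative, known to order k, with an undifferentiated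
    factor, known to order k + 1. \<open>Ck_on_SucD\<close> lowers the latter so that the induction
    hypothesis applies to both summands.\<close>
  have "Ck_on k U (\<lambda>x. frechet_derivative (\<lambda>x. b (f x) (g x)) (at x) v)" for v
    by (rule Ck_on_cong[OF assms(2), of
        "\<lambda>x. b (f x) (frechet_derivative g (at x) v) + b (frechet_derivative f (at x) v) (g x)"])
      (use Suc Ck_on_SucD[OF Suc.prems(1)] Ck_on_SucD[OF Suc.prems(2)] fun_cong[OF frechet_derivative_at[OF d]] in
        \<open>auto intro!: Ck_on_add[OF assms(2)]\<close>)
  then show ?case using d by (auto simp: differentiable_def)
qed

lemma smooth_on_const: "smooth_on U (\<lambda>x. c)"
  by (simp add: smooth_on_def Ck_on_const)

lemma smooth_on_id: "open U \<Longrightarrow> smooth_on U (\<lambda>x. x)"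
  by (simp add: smooth_on_def Ck_on_id)

lemma smooth_on_bounded_linear:
  "bounded_linear L \<Longrightarrow> open U \<Longrightarrow> smooth_on U f \<Longrightarrow> smooth_on U (\<lambda>x. L (f x))"
  by (simp add: smooth_on_def Ck_on_bounded_linear)

lemma smooth_on_add:
  "open U \<Longrightarrow> smooth_on U f \<Longrightarrow> smooth_on U g \<Longrightarrow> smooth_on U (\<lambda>x. f x + g x)"
  by (simp add: smooth_on_def Ck_on_add)

lemma smooth_on_bilinear:
  "bounded_bilinear b \<Longrightarrow> open U \<Longrightarrow> smooth_on U f \<Longrightarrow> smooth_on U g \<Longrightarrow> smooth_on U (\<lambda>x. b (f x) (g x))"
  by (simp add: smooth_on_def Ck_on_bilinear)

lemma smooth_on_sum:
  "open U \<Longrightarrow> (\<And>i. i \<in> I \<Longrightarrow> smooth_on U (f i)) \<Longrightarrow> smooth_on U (\<lambda>x. \<Sum>i\<in>I. f i x)"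
  by (induction I rule: infinite_finite_induct) (auto intro: smooth_on_add smooth_on_const)

lemma smooth_on_inner_scaleR:
  "open U \<Longrightarrow> smooth_on U X \<Longrightarrow> smooth_on U (\<lambda>x. (X x \<bullet> i) *\<^sub>R j)"
  by (intro smooth_on_bounded_linear[of "\<lambda>y. (y \<bullet> i) *\<^sub>R j"]) (auto intro!: bounded_linear_intros)

lemma smooth_on_inner:
  "open U \<Longrightarrow> smooth_on U X \<Longrightarrow> smooth_on U (\<lambda>x. X x \<bullet> i)"
  by (rule smooth_on_bounded_linear[OF bounded_linear_inner_left])

lemma smooth_on_imp_differentiable:
  "smooth_on U X \<Longrightarrow> z \<in> U \<Longrightarrow> X differentiable (at z)"
  unfolding smooth_on_def by (metis Ck_on.simps(2))

section \<open>Christoffel symbols of an affine connection\<close>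

lemma
  assumes "affine_connection U D" "z \<in> U"
  shows connection_add_left: "smooth_on U X \<Longrightarrow> smooth_on U X' \<Longrightarrow> smooth_on U Y \<Longrightarrow>
      D (\<lambda>x. X x + X' x) Y z = D X Y z + D X' Y z"
    and connection_scaleR_left: "smooth_on U f \<Longrightarrow> smooth_on U X \<Longrightarrow> smooth_on U Y \<Longrightarrow>
      D (\<lambda>x. f x *\<^sub>R X x) Y z = f z *\<^sub>R D X Y z"
    and connection_add_right: "smooth_on U X \<Longrightarrow> smooth_on U Y \<Longrightarrow> smooth_on U Y' \<Longrightarrow>
      D X (\<lambda>x. Y x + Y' x) z = D X Y z + D X Y' z"
    and connection_scaleR_right: "smooth_on U f \<Longrightarrow> smooth_on U X \<Longrightarrow> smooth_on U Y \<Longrightarrow>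
      D X (\<lambda>x. f x *\<^sub>R Y x) z = dir_deriv X f z *\<^sub>R Y z + f z *\<^sub>R D X Y z"
  using assms by (simp_all add: affine_connection_def)

lemma connection_sum_left:
  assumes "affine_connection U D" "open U" "z \<in> U" "smooth_on U Y"
    "\<And>i. i \<in> I \<Longrightarrow> smooth_on U (X i)" "finite I"
  shows "D (\<lambda>x. \<Sum>i\<in>I. X i x) Y z = (\<Sum>i\<in>I. D (X i) Y z)"
  using assms(6,5)
proof (induction I)
  case empty
  \<comment> \<open>The zero field is written as the function 0 times the zero field, which turns
    the scaling axiom into D 0 Y = 0.\<close>
  have "D (\<lambda>x. 0 *\<^sub>R 0) Y z = 0 *\<^sub>R D (\<lambda>x. 0) Y z"
    by (rule connection_scaleR_left[OF assms(1,3) smooth_on_const smooth_on_const assms(4)])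
  then show ?case by simp
next
  case (insert i I)
  have "smooth_on U (\<lambda>x. \<Sum>i\<in>I. X i x)"
    using insert by (intro smooth_on_sum[OF assms(2)]) auto
  then have "D (\<lambda>x. X i x + (\<Sum>i\<in>I. X i x)) Y z = D (X i) Y z + D (\<lambda>x. \<Sum>i\<in>I. X i x) Y z"
    using insert.prems by (intro connection_add_left[OF assms(1,3) _ _ assms(4)]) auto
  then show ?case using insert by simp
qed

lemma connection_sum_right:
  assumes "affine_connection U D" "open U" "z \<in> U" "smooth_on U X"
    "\<And>i. i \<in> I \<Longrightarrow> smooth_on U (Y i)" "finite I"
  shows "D X (\<lambda>x. \<Sum>i\<in>I. Y i x) z = (\<Sum>i\<in>I. D X (Y i) z)"
  using assms(6,5)
proof (induction I)
  case empty
  have "D X (\<lambda>x. 0 *\<^sub>R 0) z = dir_deriv X (\<lambda>_. 0::real) z *\<^sub>R 0 + 0 *\<^sub>R D X (\<lambda>x. 0) z"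
    by (rule connection_scaleR_right[OF assms(1,3) smooth_on_const assms(4) smooth_on_const])
  then show ?case by simp
next
  case (insert i I)
  have "smooth_on U (\<lambda>x. \<Sum>i\<in>I. Y i x)"
    using insert by (intro smooth_on_sum[OF assms(2)]) auto
  then have "D X (\<lambda>x. Y i x + (\<Sum>i\<in>I. Y i x)) z = D X (Y i) z + D X (\<lambda>x. \<Sum>i\<in>I. Y i x) z"
    using insert.prems by (intro connection_add_right[OF assms(1,3,4)]) auto
  then show ?case using insert by simp
qed

lemma connection_left_expand:
  fixes X :: "'a::euclidean_space \<Rightarrow> 'a"
  assumes "affine_connection U D" "open U" "z \<in> U" "smooth_on U X" "smooth_on U Y"
  shows "D X Y z = (\<Sum>i\<in>Basis. (X z \<bullet> i) *\<^sub>R D (\<lambda>_. i) Y z)"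
proof -
  have "D X Y z = D (\<lambda>x. \<Sum>i\<in>Basis. (X x \<bullet> i) *\<^sub>R i) Y z"
    by (simp add: euclidean_representation)
  also have "\<dots> = (\<Sum>i\<in>Basis. D (\<lambda>x. (X x \<bullet> i) *\<^sub>R i) Y z)"
    by (rule connection_sum_left[OF assms(1-3,5)]) (auto intro: smooth_on_inner_scaleR assms)
  finally have "D X Y z = (\<Sum>i\<in>Basis. D (\<lambda>x. (X x \<bullet> i) *\<^sub>R i) Y z)" .
  moreover have "D (\<lambda>x. (X x \<bullet> i) *\<^sub>R i) Y z = (X z \<bullet> i) *\<^sub>R D (\<lambda>_. i) Y z" for i
    by (rule connection_scaleR_left[OF assms(1,3) smooth_on_inner[OF assms(2,4)] smooth_on_const assms(5)])
  ultimately show ?thesis by simp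
qed

lemma connection_right_expand:
  fixes X :: "'a::euclidean_space \<Rightarrow> 'a"
  assumes "affine_connection U D" "open U" "z \<in> U" "smooth_on U X" "smooth_on U Y"
  shows "D X Y z = dir_deriv X Y z + (\<Sum>i\<in>Basis. (Y z \<bullet> i) *\<^sub>R D X (\<lambda>_. i) z)"
proof -
  have dd: "dir_deriv X (\<lambda>x. Y x \<bullet> i) z = dir_deriv X Y z \<bullet> i" for i
  proof -
    have "((\<lambda>x. Y x \<bullet> i) has_derivative (\<lambda>v. frechet_derivative Y (at z) v \<bullet> i)) (at z)"
      using smooth_on_imp_differentiable[OF assms(5,3)]
      by (intro has_derivative_inner_left) (simp add: frechet_derivative_works)
    then show ?thesis unfolding dir_deriv_def by (simp add: frechet_derivative_at[symmetric])
  qed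
  have "D X Y z = D X (\<lambda>x. \<Sum>i\<in>Basis. (Y x \<bullet> i) *\<^sub>R i) z"
    by (simp add: euclidean_representation)
  also have "\<dots> = (\<Sum>i\<in>Basis. D X (\<lambda>x. (Y x \<bullet> i) *\<^sub>R i) z)"
    by (rule connection_sum_right[OF assms(1-4)]) (auto intro: smooth_on_inner_scaleR assms)
  finally have "D X Y z = (\<Sum>i\<in>Basis. D X (\<lambda>x. (Y x \<bullet> i) *\<^sub>R i) z)" .
  moreover have "D X (\<lambda>x. (Y x \<bullet> i) *\<^sub>R i) z = (dir_deriv X Y z \<bullet> i) *\<^sub>R i + (Y z \<bullet> i) *\<^sub>R D X (\<lambda>_. i) z" for i
    unfolding dd[symmetric]
    by (rule connection_scaleR_right[OF assms(1,3) smooth_on_inner[OF assms(2,5)] assms(4) smooth_on_const])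
  ultimately show ?thesis by (simp add: sum.distrib euclidean_representation)
qed

text \<open>Expanding both fields in the constant frame, function-linearity in the first slot and
  the Leibniz rule in the second leave the coordinate derivative plus a term that sees only the
  values at \<open>z\<close>. Hence D on constant fields is the Christoffel symbol, and differences
  of connections are tensorial.\<close>

lemma connection_christoffel:
  fixes X :: "'a::euclidean_space \<Rightarrow> 'a"
  assumes "affine_connection U D" "open U" "z \<in> U" "smooth_on U X" "smooth_on U Y"
  shows "D X Y z = dir_deriv X Y z + D (\<lambda>_. X z) (\<lambda>_. Y z) z"
proof -
  have 1: "D X (\<lambda>_. Y z) z = (\<Sum>i\<in>Basis. (Y z \<bullet> i) *\<^sub>R D X (\<lambda>_. i) z)"
    using connection_right_expand[OF assms(1-4) smooth_on_const, of "Y z"] by (simp add: dir_deriv_def)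
  have 2: "D (\<lambda>_. X z) (\<lambda>_. Y z) z = D X (\<lambda>_. Y z) z"
    using connection_left_expand[OF assms(1-4) smooth_on_const, of "Y z"]
      connection_left_expand[OF assms(1-3) smooth_on_const smooth_on_const, of "X z" "Y z"] by simp
  show ?thesis using connection_right_expand[OF assms] 1 2 by simp
qed

lemma levi_civita_christoffel:
  fixes g :: "'a::euclidean_space \<Rightarrow> 'a \<Rightarrow> 'a \<Rightarrow> real"
  assumes lc: "levi_civita U g D" and "open U" "z \<in> U"
    and lin: "\<And>v. linear (\<lambda>u. g z u v)" and sym: "\<And>u v. g z u v = g z v u"
    and sym_\<Gamma>: "\<And>u v. \<Gamma> u v = \<Gamma> v u"
    and der: "\<And>v w. ((\<lambda>x. g x v w) has_derivative (\<lambda>u. g z (\<Gamma> u v) w + g z v (\<Gamma> u w))) (at z)"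
  shows "g z (D (\<lambda>_. u) (\<lambda>_. v) z) w = g z (\<Gamma> u v) w"
proof -
  define \<delta> where "\<delta> u v w = g z (D (\<lambda>_. u) (\<lambda>_. v) z - \<Gamma> u v) w" for u v w
  have \<delta>: "\<delta> u v w = g z (D (\<lambda>_. u) (\<lambda>_. v) z) w - g z (\<Gamma> u v) w" for u v w
    unfolding \<delta>_def by (rule linear_diff[OF lin])
  have s: "\<delta> u v w = \<delta> v u w" for u v w
  proof -
    have "D (\<lambda>_. u) (\<lambda>_. v) z - D (\<lambda>_. v) (\<lambda>_. u) z = dir_deriv (\<lambda>_. u) (\<lambda>_. v) z - dir_deriv (\<lambda>_. v) (\<lambda>_. u) z"
      using lc assms(3) smooth_on_const unfolding levi_civita_def by blast
    then show ?thesis by (simp add: \<delta>_def dir_deriv_def sym_\<Gamma>[of u])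
  qed
  have a: "\<delta> u v w = - \<delta> u w v" for u v w
  proof -
    have "dir_deriv (\<lambda>_. u) (\<lambda>x. g x v w) z = g z (D (\<lambda>_. u) (\<lambda>_. v) z) w + g z v (D (\<lambda>_. u) (\<lambda>_. w) z)"
      using lc assms(3) smooth_on_const[of U u] smooth_on_const[of U v] smooth_on_const[of U w]
      unfolding levi_civita_def by blast
    moreover have "dir_deriv (\<lambda>_. u) (\<lambda>x. g x v w) z = g z (\<Gamma> u v) w + g z v (\<Gamma> u w)"
      unfolding dir_deriv_def by (simp add: frechet_derivative_at[OF der, symmetric])
    ultimately show ?thesis by (simp add: \<delta> sym[of v])
  qed
  \<comment> \<open>Symmetric in the first pair and skew in the last pair: alternating the two
    exchanges six times returns to the same arguments with the sign reversed.\<close>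
  have "\<delta> u v w = 0" using s[of u v w] a[of v u w] s[of v w u] a[of w v u] s[of w u v] a[of u w v]
    by simp
  then show ?thesis by (simp add: \<delta>)
qed

section \<open>The matrix exponential and Lie algebras\<close>

lemma bounded_bilinear_matrix_mult: "bounded_bilinear ((**) :: complex^'k^'k \<Rightarrow> complex^'k^'k \<Rightarrow> complex^'k^'k)"
proof -
  have "bilinear ((**) :: complex^'k^'k \<Rightarrow> complex^'k^'k \<Rightarrow> complex^'k^'k)"
    unfolding bilinear_def
    by (auto intro!: linearI simp: matrix_add_ldistrib matrix_scalar_ac scalar_matrix_assoc
        vec_eq_iff matrix_matrix_mult_def sum.distrib algebra_simps scaleR_sum_right)
  then show ?thesis unfolding bilinear_conv_bounded_bilinear .
qed

interpretation mmul: bounded_bilinear "(**) :: complex^'k^'k \<Rightarrow> complex^'k^'k \<Rightarrow> complex^'k^'k"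
  by (rule bounded_bilinear_matrix_mult)

lemma mexp_sums: "(\<lambda>k. (1 / fact k) *\<^sub>R (((**) A ^^ k) (mat 1))) sums mexp A"
  for A :: "complex^'k^'k"
  unfolding sums_def
proof (intro vec_tendstoI)
  fix i j
  show "(\<lambda>n. (\<Sum>k<n. (1 / fact k) *\<^sub>R (((**) A ^^ k) (mat 1))) $ i $ j) \<longlonglongrightarrow> mexp A $ i $ j"
    using mexp_entry_sums[of A i j 1]
    by (simp add: sums_def scaleR_conv_of_real[where 'a=complex] mult_ac)
qed

lemma matpow_add:
  fixes A :: "complex^'k^'k"
  shows "((**) A ^^ m) (mat 1) ** ((**) A ^^ n) (mat 1) = ((**) A ^^ (m + n)) (mat 1)"
  by (induction m) (auto simp: matrix_mul_assoc[symmetric])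

lemma matpow_uminus:
  fixes A :: "complex^'k^'k"
  shows "((**) (- A) ^^ k) (mat 1) = (- 1) ^ k *\<^sub>R ((**) A ^^ k) (mat 1)"
  by (induction k) (auto simp: mmul.minus_left mmul.scaleR_right)

text \<open>The Cauchy product of the two series is formed entry by entry. Its term of degree k is a
  multiple of the alternating sum of the binomial coefficients of k, so only degree 0
  survives.\<close>

lemma mexp_mult_mexp_uminus:
  fixes A :: "complex^'k^'k"
  shows "mexp A ** mexp (- A) = mat 1"
proof -
  define P where "P k = ((**) A ^^ k) (mat 1)" for k
  have P: "(\<Sum>l\<in>UNIV. P m $ i $ l * P n $ l $ j) = P (m + n) $ i $ j" for m n i j
    using matpow_add[of m A n] by (simp add: P_def[symmetric] vec_eq_iff matrix_matrix_mult_def)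
  define a where "a i j k = P k $ i $ j / fact k" for i j k
  have na: "summable (\<lambda>k. norm (a i j k))" "summable (\<lambda>k. norm ((-1) ^ k * a i j k))" for i j
  proof -
    show "summable (\<lambda>k. norm (a i j k))"
    proof (rule summable_comparison_test)
      show "summable (\<lambda>k. inverse (fact k) * (CARD('k) * norm A) ^ k :: real)"
        by (rule summable_exp)
      show "\<exists>N. \<forall>n\<ge>N. norm (norm (a i j n)) \<le> inverse (fact n) * (real CARD('k) * norm A) ^ n"
        using norm_matpow_nth[of _ A i j]
        by (auto simp: a_def P_def norm_divide divide_simps intro!: exI[of _ 0])
    qed
    then show "summable (\<lambda>k. norm ((-1) ^ k * a i j k))" by (simp add: norm_mult norm_power)
  qed
  have s1: "mexp A $ i $ j = suminf (a i j)" for i j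
    using sums_unique[OF mexp_entry_sums[of A i j 1]] by (simp add: a_def[abs_def] P_def)
  have s2: "mexp (- A) $ i $ j = (\<Sum>k. (-1) ^ k * a i j k)" for i j
    using sums_unique[OF mexp_entry_sums[of "- A" i j 1]]
    by (simp add: a_def[abs_def] P_def matpow_uminus scaleR_conv_of_real[where 'a=complex])
  have alt: "(\<Sum>m\<le>k. (- 1) ^ (k - m) / (fact m * fact (k - m))) = (if k = 0 then 1 else 0 :: complex)" for k :: nat
  proof -
    have "(\<Sum>m\<le>k. (- 1) ^ (k - m) / (fact m * fact (k - m)) :: complex)
        = (\<Sum>m\<le>k. (- 1) ^ m / (fact (k - m) * fact m))"
      by (rule sum.reindex_bij_witness[of _ "\<lambda>m. k - m" "\<lambda>m. k - m"]) auto
    also have "\<dots> = (\<Sum>m\<le>k. (- 1) ^ m * of_nat (k choose m)) / fact k"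
      by (auto simp: sum_divide_distrib binomial_fact field_simps intro!: sum.cong)
    finally show ?thesis using choose_alternating_sum[of k, where 'a=complex] by auto
  qed
  have "(mexp A ** mexp (- A)) $ i $ j = mat 1 $ i $ j" for i j
  proof -
    have "(\<lambda>k. \<Sum>m\<le>k. a i l m * ((-1) ^ (k - m) * a l j (k - m))) sums (mexp A $ i $ l * mexp (- A) $ l $ j)" for l
      unfolding s1 s2 by (rule Cauchy_product_sums[OF na(1) na(2)])
    then have "(\<lambda>k. \<Sum>l\<in>UNIV. \<Sum>m\<le>k. a i l m * ((-1) ^ (k - m) * a l j (k - m))) sums ((mexp A ** mexp (- A)) $ i $ j)"
      unfolding matrix_matrix_mult_def by (auto intro: sums_sum)
    also have "(\<lambda>k. \<Sum>l\<in>UNIV. \<Sum>m\<le>k. a i l m * ((-1) ^ (k - m) * a l j (k - m)))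
       = (\<lambda>k. if k = 0 then mat 1 $ i $ j else 0)"
    proof
      fix k
      have "(\<Sum>l\<in>UNIV. \<Sum>m\<le>k. a i l m * ((-1) ^ (k - m) * a l j (k - m)))
          = (\<Sum>m\<le>k. (-1) ^ (k - m) / (fact m * fact (k - m)) * (\<Sum>l\<in>UNIV. P m $ i $ l * P (k - m) $ l $ j))"
        by (subst sum.swap) (auto simp: a_def sum_distrib_left field_simps intro!: sum.cong)
      also have "\<dots> = (\<Sum>m\<le>k. (-1) ^ (k - m) / (fact m * fact (k - m))) * P k $ i $ j"
        by (simp add: P sum_distrib_right)
      finally show "(\<Sum>l\<in>UNIV. \<Sum>m\<le>k. a i l m * ((-1) ^ (k - m) * a l j (k - m))) = (if k = 0 then mat 1 $ i $ j else 0)"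
        unfolding alt by (simp add: P_def)
    qed
    finally show ?thesis using sums_unique2[OF _ sums_single[of 0 "\<lambda>_. mat 1 $ i $ j"]] by blast
  qed
  then show ?thesis by (simp add: vec_eq_iff)
qed

lemma invertible_mexp: "invertible (mexp A)" for A :: "complex^'k^'k"
  using mexp_mult_mexp_uminus[of A] mexp_mult_mexp_uminus[of "- A"] by (auto simp: invertible_def)

lemma
  fixes a :: "complex^'k^'k"
  assumes "invertible a"
  shows matrix_inv_right: "a ** matrix_inv a = mat 1"
    and matrix_inv_left: "matrix_inv a ** a = mat 1"
  using someI_ex[OF assms[unfolded invertible_def]] by (auto simp: matrix_inv_def)

lemma mexp_conjugate:
  fixes a X :: "complex^'k^'k"
  assumes "invertible a"
  shows "mexp (a ** X ** matrix_inv a) = a ** mexp X ** matrix_inv a"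
proof -
  have "((**) (a ** X ** matrix_inv a) ^^ k) (mat 1) = a ** ((**) X ^^ k) (mat 1) ** matrix_inv a" for k
  proof (induction k)
    case 0
    then show ?case using assms by (simp add: matrix_inv_right)
  next
    case (Suc k)
    let ?P = "((**) X ^^ k) (mat 1)"
    have "(a ** X ** matrix_inv a) ** (a ** ?P ** matrix_inv a)
        = a ** X ** (matrix_inv a ** a) ** ?P ** matrix_inv a"
      by (simp add: matrix_mul_assoc)
    then show ?case using Suc assms by (simp add: matrix_inv_left matrix_mul_assoc)
  qed
  moreover have "bounded_linear (\<lambda>Y. a ** Y ** matrix_inv a)"
    using mmul.bounded_linear_left mmul.bounded_linear_right bounded_linear_compose by blast
  from bounded_linear.sums[OF this mexp_sums[of X]]
  have "(\<lambda>k. a ** ((1 / fact k) *\<^sub>R ((**) X ^^ k) (mat 1)) ** matrix_inv a) sums (a ** mexp X ** matrix_inv a)" .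
  ultimately show ?thesis
    using mexp_sums[of "a ** X ** matrix_inv a"] sums_unique2
    by (fastforce simp: mmul.scaleR_left mmul.scaleR_right)
qed

lemma lie_algebra_Ad:
  assumes "matrix_group K" "a \<in> K" "X \<in> lie_algebra K"
  shows "a ** X ** matrix_inv a \<in> lie_algebra K"
proof -
  have "invertible a" "matrix_inv a \<in> K" using assms by (auto simp: matrix_group_def)
  then have "mexp (t *\<^sub>R (a ** X ** matrix_inv a)) \<in> K" for t
    using mexp_conjugate[of a "t *\<^sub>R X"] assms
    by (simp add: mmul.scaleR_left mmul.scaleR_right lie_algebra_def matrix_group_def)
  then show ?thesis by (simp add: lie_algebra_def)
qed

text \<open>With b = \<open>matrix_inv a - mat 1\<close> one has b = -(a - 1)(b + 1). Close to the
  identity this bounds b by a multiple of a - 1, which gives continuity of inversion at the identity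
  without any formula for the inverse.\<close>

lemma tendsto_matrix_inv:
  fixes a :: "'x \<Rightarrow> complex^'k^'k"
  assumes "(a \<longlongrightarrow> mat 1) F" "\<And>x. invertible (a x)"
  shows "((\<lambda>x. matrix_inv (a x)) \<longlongrightarrow> mat 1) F"
proof -
  obtain C where C: "C > 0" "\<And>(X :: complex^'k^'k) (Y :: complex^'k^'k). norm (X ** Y) \<le> norm X * norm Y * C"
    using bounded_bilinear.pos_bounded[OF bounded_bilinear_matrix_mult] by metis
  have z: "((\<lambda>x. norm (a x - mat 1)) \<longlongrightarrow> 0) F"
    using tendsto_norm[OF LIM_zero[OF assms(1)]] by simp
  \<comment> \<open>\<open>C\<close> bounds matrix multiplication; with this radius the occurrence
    of b on the right enters with factor at most 1/2 and can be absorbed on the left.\<close>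
  have "eventually (\<lambda>x. norm (a x - mat 1) < 1 / (2 * C)) F"
    by (rule order_tendstoD(2)[OF z]) (use C(1) in simp)
  then have "eventually (\<lambda>x. norm (matrix_inv (a x) - mat 1) \<le> 2 * C * norm (mat 1 :: complex^'k^'k) * norm (a x - mat 1)) F"
  proof eventually_elim
    case (elim x)
    let ?b = "matrix_inv (a x) - mat 1" and ?n = "norm (mat 1 :: complex^'k^'k)"
    have "(a x - mat 1) ** matrix_inv (a x) = - ?b"
      using assms(2)[of x] by (simp add: mmul.diff_left matrix_inv_right)
    then have "?b = - ((a x - mat 1) ** (?b + mat 1))" by simp
    then have "norm ?b \<le> norm (a x - mat 1) * norm (?b + mat 1) * C"
      using C(2)[of "a x - mat 1" "?b + mat 1"] by (metis norm_minus_cancel)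
    also have "\<dots> \<le> norm (a x - mat 1) * (norm ?b + ?n) * C"
      using C(1) norm_triangle_ineq[of ?b "mat 1"] by (intro mult_right_mono mult_left_mono) auto
    also have "\<dots> = (norm (a x - mat 1) * C) * norm ?b + norm (a x - mat 1) * ?n * C"
      by (simp add: algebra_simps)
    also have "\<dots> \<le> 1 / 2 * norm ?b + norm (a x - mat 1) * ?n * C"
      using elim C(1) by (intro add_right_mono mult_right_mono) (auto simp: field_simps)
    finally show ?case by (simp add: algebra_simps)
  qed
  moreover have "((\<lambda>x. 2 * C * norm (mat 1 :: complex^'k^'k) * norm (a x - mat 1)) \<longlongrightarrow> 0) F"
    using tendsto_mult_left[OF z, of "2 * C * norm (mat 1 :: complex^'k^'k)"] by simp
  ultimately have "((\<lambda>x. matrix_inv (a x) - mat 1) \<longlongrightarrow> 0) F"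
    by (rule Lim_null_comparison)
  then show ?thesis by (rule LIM_zero_cancel)
qed

lemma mexp_has_vector_derivative:
  fixes A :: "complex^'k^'k"
  shows "((\<lambda>t. mexp (t *\<^sub>R A)) has_vector_derivative A) (at 0)"
  using mexp_entry_deriv[of A]
  unfolding has_vector_derivative_def has_derivative_def
  by (auto intro!: vec_tendstoI bounded_linear_scaleR_left)

lemma mexp_difference_quotient:
  fixes A :: "complex^'k^'k"
  shows "((\<lambda>t. (mexp (t *\<^sub>R A) - mat 1) /\<^sub>R t) \<longlongrightarrow> A) (at 0)"
proof -
  have "((\<lambda>t. (1 / norm t) *\<^sub>R (mexp (t *\<^sub>R A) - (mat 1 + t *\<^sub>R A))) \<longlongrightarrow> 0) (at 0)"
    using mexp_has_vector_derivative[of A]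
    by (simp add: has_vector_derivative_def has_derivative_at2 mexp_zero)
  then have "((\<lambda>t. norm ((1 / norm t) *\<^sub>R (mexp (t *\<^sub>R A) - (mat 1 + t *\<^sub>R A)))) \<longlongrightarrow> 0) (at 0)"
    by (rule tendsto_norm_zero)
  also have "?this \<longleftrightarrow> ((\<lambda>t. norm ((mexp (t *\<^sub>R A) - mat 1) /\<^sub>R t - A)) \<longlongrightarrow> 0) (at 0)"
  proof (rule tendsto_cong)
    have "norm ((1 / norm t) *\<^sub>R (mexp (t *\<^sub>R A) - (mat 1 + t *\<^sub>R A))) = norm ((mexp (t *\<^sub>R A) - mat 1) /\<^sub>R t - A)"
      if "t \<noteq> 0" for t
    proof -
      have "(mexp (t *\<^sub>R A) - mat 1) /\<^sub>R t - A = (mexp (t *\<^sub>R A) - (mat 1 + t *\<^sub>R A)) /\<^sub>R t"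
        using that by (simp add: algebra_simps)
      then show ?thesis by (simp add: divide_simps)
    qed
    then show "\<forall>\<^sub>F t in at 0. norm ((1 / norm t) *\<^sub>R (mexp (t *\<^sub>R A) - (mat 1 + t *\<^sub>R A))) = norm ((mexp (t *\<^sub>R A) - mat 1) /\<^sub>R t - A)"
      by (auto simp: eventually_at_filter)
  qed
  finally show ?thesis by (rule LIM_zero_cancel[OF tendsto_norm_zero_cancel])
qed

text \<open>The derivative of \<open>t \<mapsto> exp (tK) Y exp (-tK)\<close> at \<open>0\<close> is \<open>[K, Y]\<close>.\<close>

lemma comm_mem_of_Ad_invariant:
  fixes S :: "(complex^'k^'k) set"
  assumes "K \<in> lie_algebra P" "subspace S" "Y \<in> S" "\<And>a X. a \<in> P \<Longrightarrow> X \<in> S \<Longrightarrow> a ** X ** matrix_inv a \<in> S"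
  shows "comm K Y \<in> S"
proof -
  define a where "a t = mexp (t *\<^sub>R K)" for t :: real
  have inv: "invertible (a t)" for t by (simp add: a_def invertible_mexp)
  have d: "((\<lambda>t. (a t - mat 1) /\<^sub>R t) \<longlongrightarrow> K) (at 0)"
    unfolding a_def by (rule mexp_difference_quotient)
  have c: "(a \<longlongrightarrow> mat 1) (at 0)"
    using has_vector_derivative_continuous[OF mexp_has_vector_derivative[of K]]
    by (simp add: continuous_at a_def[abs_def] mexp_zero isCont_def)
  have "((\<lambda>t. (((a t - mat 1) /\<^sub>R t) ** Y - Y ** ((a t - mat 1) /\<^sub>R t)) ** matrix_inv (a t))
      \<longlongrightarrow> (K ** Y - Y ** K) ** mat 1) (at 0)"
    by (intro tendsto_diff mmul.tendsto d tendsto_const tendsto_matrix_inv[OF c inv])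
  \<comment> \<open>Pulling \<open>matrix_inv (a t)\<close> out on the right avoids differentiating
    the inverse: only its limit at t = 0 is needed.\<close>
  moreover have "(((a t - mat 1) /\<^sub>R t) ** Y - Y ** ((a t - mat 1) /\<^sub>R t)) ** matrix_inv (a t)
      = (a t ** Y ** matrix_inv (a t) - Y) /\<^sub>R t" for t
  proof -
    have "Y ** a t ** matrix_inv (a t) = Y"
      using inv[of t] by (simp add: matrix_mul_assoc[symmetric] matrix_inv_right)
    then show ?thesis
      by (simp add: mmul.scaleR_left mmul.scaleR_right mmul.diff_left mmul.diff_right scaleR_diff_right)
  qed
  ultimately have l: "((\<lambda>t. (a t ** Y ** matrix_inv (a t) - Y) /\<^sub>R t) \<longlongrightarrow> comm K Y) (at 0)"
    by (simp add: comm_def)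
  have "(a t ** Y ** matrix_inv (a t) - Y) /\<^sub>R t \<in> S" for t
    using assms by (auto intro!: subspace_scale subspace_diff simp: a_def lie_algebra_def)
  then show ?thesis
    using Lim_in_closed_set[OF closed_subspace[OF assms(2)] _ _ l] by simp
qed

section \<open>Centralizers\<close>

text \<open>All that is needed of \<open>\<hh>\<close> is that it centralizes \<open>A\<^sub>0\<close> and \<open>N\<^sub>2\<close>: such a condition passes from
  generators to the group they span and on to its Lie algebra.\<close>

definition centralizer :: "(complex^'k^'k) set \<Rightarrow> (complex^'k^'k) set" where
  "centralizer S = {K. \<forall>M\<in>S. K ** M = M ** K}"

lemma subspace_centralizer: "subspace (centralizer S)"
  by (auto simp: subspace_def centralizer_def mmul.add_left mmul.add_right mmul.scaleR_left mmul.scaleR_right)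

lemma mexp_in_centralizer:
  assumes "X \<in> centralizer S"
  shows "mexp X \<in> centralizer S"
proof -
  have "((**) X ^^ k) (mat 1) \<in> centralizer S" for k
  proof (induction k)
    case (Suc k)
    then show ?case using assms by (simp add: centralizer_def) (metis matrix_mul_assoc)
  qed (simp add: centralizer_def)
  then have "(\<Sum>k<n. (1 / fact k) *\<^sub>R (((**) X ^^ k) (mat 1))) \<in> centralizer S" for n
    by (intro subspace_sum subspace_scale subspace_centralizer)
  then show ?thesis
    using Lim_in_closed_set[OF closed_subspace[OF subspace_centralizer] _ _ mexp_sums[of X, unfolded sums_def]]
    by simp
qed

lemma matrix_group_centralizer: "matrix_group {a \<in> centralizer S. invertible a}"
proof -
  have "matrix_inv a \<in> centralizer S" if "a \<in> centralizer S" "invertible a" for a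
  proof -
    have "matrix_inv a ** M = M ** matrix_inv a" if "M \<in> S" for M
    proof -
      have "matrix_inv a ** M = matrix_inv a ** (M ** a) ** matrix_inv a"
        using \<open>invertible a\<close> by (simp add: matrix_mul_assoc[symmetric] matrix_inv_right)
      also have "M ** a = a ** M"
        using \<open>a \<in> centralizer S\<close> that by (simp add: centralizer_def)
      also have "matrix_inv a ** (a ** M) ** matrix_inv a = matrix_inv a ** a ** M ** matrix_inv a"
        by (simp add: matrix_mul_assoc)
      finally show ?thesis using \<open>invertible a\<close> by (simp add: matrix_inv_left)
    qed
    then show ?thesis by (simp add: centralizer_def)
  qed
  moreover have "invertible (matrix_inv a)" if "invertible a" for a :: "complex^'k^'k"
    using that matrix_inv_left matrix_inv_right invertible_def by blast
  moreover have "a ** b \<in> centralizer S" if "a \<in> centralizer S" "b \<in> centralizer S" for a b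
    using that by (simp add: centralizer_def) (metis matrix_mul_assoc)
  ultimately show ?thesis
    by (auto simp: matrix_group_def invertible_mult) (auto simp: centralizer_def invertible_def)
qed

text \<open>The quotients (exp(tX) - 1)/t stay in \<open>S\<close> and tend to X, and a subspace of
  a finite-dimensional space is closed. So a linear constraint on a group is inherited by its Lie
  algebra.\<close>

lemma lie_algebra_subset_subspace:
  assumes "K \<subseteq> S" "subspace S" "mat 1 \<in> S"
  shows "lie_algebra K \<subseteq> S"
proof
  fix X assume "X \<in> lie_algebra K"
  then have "(mexp (t *\<^sub>R X) - mat 1) /\<^sub>R t \<in> S" for t
    using assms by (intro subspace_scale subspace_diff) (auto simp: lie_algebra_def)
  then show "X \<in> S"
    using Lim_in_closed_set[OF closed_subspace[OF assms(2)] _ _ mexp_difference_quotient[of X]] by simp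
qed

text \<open>The invertible elements of the centralizer form a group containing the generating
  exponentials, so they contain everything these generate.\<close>

lemma lie_algebra_group_span_subset:
  assumes "S \<subseteq> centralizer M"
  shows "lie_algebra (group_span (mexp ` S)) \<subseteq> centralizer M"
proof (rule lie_algebra_subset_subspace[OF _ subspace_centralizer])
  have "mexp ` S \<subseteq> {a \<in> centralizer M. invertible a}"
    using assms mexp_in_centralizer invertible_mexp by blast
  then show "group_span (mexp ` S) \<subseteq> centralizer M"
    using matrix_group_centralizer[of M] unfolding group_span_def by blast
qed (simp add: centralizer_def)

lemma matrix_group_Int_group_span: "matrix_group K \<Longrightarrow> matrix_group (K \<inter> group_span S)"
  unfolding matrix_group_def group_span_def by auto

section \<open>Infinitesimal generators\<close>

lemma lift_vec_1: "lift_vec 1 z = lift_vec 1 0 + lift_vec 0 z"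
  by (auto simp: vec_eq_iff lift_vec_def split: option.splits)

lemma linear_lift_vec_0: "linear (lift_vec 0)"
  by (auto intro!: linearI simp: vec_eq_iff lift_vec_def split: option.splits)

lemma bounded_bilinear_vector_scalar_mult:
  "bounded_bilinear ((*s) :: complex \<Rightarrow> complex^'n \<Rightarrow> complex^'n)"
proof -
  have "bilinear ((*s) :: complex \<Rightarrow> complex^'n \<Rightarrow> complex^'n)"
    unfolding bilinear_def by (auto intro!: linearI simp: vec_eq_iff algebra_simps)
  then show ?thesis unfolding bilinear_conv_bounded_bilinear .
qed

definition gen_deriv ::
  "complex^('n option)^('n option) \<Rightarrow> complex^'n::finite \<Rightarrow> complex^'n \<Rightarrow> complex^'n" where
  "gen_deriv B z c = (\<chi> j. (B *v lift_vec 0 c) $ Some j - (B *v lift_vec 0 c) $ None * z $ j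
     - (B *v lift_vec 1 z) $ None * c $ j)"

lemma
  fixes B :: "complex^('n option)^('n::finite option)"
  shows gen_has_derivative: "(gen B has_derivative gen_deriv B z) (at z)"
    and smooth_on_gen: "open U \<Longrightarrow> smooth_on U (gen B)"
proof -
  define L where "L z = (\<chi> j. (B *v lift_vec 0 z) $ Some j)" for z
  define f where "f z = (B *v lift_vec 0 z) $ None" for z
  have lin: "linear (\<lambda>z. B *v lift_vec 0 z)"
    by (rule linear_compose[OF linear_lift_vec_0 matrix_vector_mul_linear, unfolded o_def])
  have L: "bounded_linear L" and f: "bounded_linear f"
    unfolding linear_conv_bounded_linear[symmetric] L_def f_def
    by (auto intro!: linearI simp: vec_eq_iff linear_add[OF lin] linear_scale[OF lin])
  define c k where "c = (\<chi> j. (B *v lift_vec 1 0) $ Some j)" and "k = (B *v lift_vec 1 0) $ None"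
  note L' = bounded_linear.has_derivative[OF L has_derivative_ident]
  note f' = bounded_linear.has_derivative[OF f has_derivative_ident]
  note s' = bounded_bilinear.FDERIV[OF bounded_bilinear_vector_scalar_mult]
  have gen: "gen B = (\<lambda>z. L z + c + - ((f z + k) *s z))"
  proof
    fix z show "gen B z = L z + c + - ((f z + k) *s z)"
      unfolding gen_formula lift_vec_1[of z] L_def f_def c_def k_def matrix_vector_right_distrib
      by (simp add: vec_eq_iff algebra_simps)
  qed
  have "((\<lambda>z. L z + c + - ((f z + k) *s z)) has_derivative
      (\<lambda>h. L h + 0 + - ((f z + k) *s h + (f h + 0) *s z))) (at z)"
    by (intro has_derivative_add has_derivative_minus s' L' f' has_derivative_const has_derivative_ident)
  also have "(\<lambda>h. L h + 0 + - ((f z + k) *s h + (f h + 0) *s z)) = gen_deriv B z"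
    unfolding gen_deriv_def lift_vec_1[of z] L_def f_def k_def matrix_vector_right_distrib
    by (simp add: fun_eq_iff vec_eq_iff algebra_simps)
  finally show "(gen B has_derivative gen_deriv B z) (at z)" unfolding gen .
  show "smooth_on U (gen B)" if "open U"
    unfolding gen
    by (intro smooth_on_add[OF that]
        smooth_on_bounded_linear[OF bounded_linear_minus[OF bounded_linear_ident] that]
        smooth_on_bilinear[OF bounded_bilinear_vector_scalar_mult that]
        smooth_on_bounded_linear[OF L that smooth_on_id[OF that]]
        smooth_on_bounded_linear[OF f that smooth_on_id[OF that]] smooth_on_id[OF that] smooth_on_const)
qed

lemma scaleR_mult_vec: "(r *\<^sub>R B) *v x = r *\<^sub>R (B *v x)" for B :: "complex^'k^'k"
  by (simp add: matrix_vector_mult_def vec_eq_iff scaleR_sum_right)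

lemma linear_gen: "linear (\<lambda>B. gen B z)"
  by (auto intro!: linearI simp: gen_formula vec_eq_iff matrix_vector_mult_add_rdistrib
      scaleR_mult_vec algebra_simps)

lemma linear_gen_deriv: "linear (\<lambda>B. gen_deriv B z c)"
  by (auto intro!: linearI simp: gen_deriv_def vec_eq_iff matrix_vector_mult_add_rdistrib
      scaleR_mult_vec algebra_simps)

lemma gen_deriv_0: "gen_deriv B z 0 = 0"
  by (simp add: gen_deriv_def linear_0[OF linear_lift_vec_0] vec_eq_iff)

text \<open>In terms of the Lie bracket of vector fields this is \<open>[B, C]\<^sup>* = - [B\<^sup>*, C\<^sup>*]\<close>.\<close>

lemma gen_comm:
  fixes B C :: "complex^('n option)^('n::finite option)"
  shows "gen (comm B C) z = gen_deriv B z (gen C z) - gen_deriv C z (gen B z)"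
proof -
  \<comment> \<open>A tangent vector is represented modulo the line of Z; subtracting this multiple
    of Z selects the representative of M Z whose \<open>None\<close>-coordinate is 0.\<close>
  have l: "lift_vec 0 (gen M z) = M *v lift_vec 1 z - (M *v lift_vec 1 z) $ None *s lift_vec 1 z" for M
    by (auto simp: vec_eq_iff gen_formula lift_vec_def split: option.splits)
  have m: "M *v (c *s x) = c *s (M *v x)" for M :: "complex^('n option)^('n option)" and c x
    by (simp add: vec_eq_iff matrix_vector_mult_def sum_distrib_left mult_ac)
  show ?thesis
    unfolding gen_deriv_def l matrix_vector_mult_diff_distrib m
    unfolding gen_formula comm_def matrix_vector_mult_diff_rdistrib matrix_vector_mul_assoc[symmetric]
    by (simp add: vec_eq_iff algebra_simps)
qed

lemma has_derivative_lift_vec_1: "(lift_vec 1 has_derivative lift_vec 0) F"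
proof -
  have eq: "lift_vec 1 = (\<lambda>z. lift_vec 1 0 + lift_vec 0 z)"
    using lift_vec_1 by blast
  have "((\<lambda>z. lift_vec 1 0 + lift_vec 0 z) has_derivative (\<lambda>z. 0 + lift_vec 0 z)) F"
    by (intro has_derivative_add has_derivative_const bounded_linear.has_derivative[OF _ has_derivative_ident]
        linear_lift_vec_0[unfolded linear_conv_bounded_linear])
  then show ?thesis by (subst eq) simp
qed

section \<open>The metric near the base point\<close>

definition herm1 :: "'n::finite \<Rightarrow> complex^'n \<Rightarrow> complex^'n \<Rightarrow> complex" where
  "herm1 p u w = (\<Sum>k\<in>-{p}. cnj (w $ k) * u $ k)"

lemma bounded_bilinear_herm: "bounded_bilinear (herm p)"
proof -
  have "bilinear (herm p)"
    unfolding bilinear_def herm_def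
    by (auto intro!: linearI simp: algebra_simps sum.distrib scaleR_sum_right)
  then show ?thesis unfolding bilinear_conv_bounded_bilinear .
qed

lemma open_CH: "open (CH p)"
proof -
  have "continuous_on UNIV (\<lambda>z. Re (herm p (lift_vec 1 z) (lift_vec 1 z)))"
    by (intro continuous_intros bounded_bilinear.continuous_on[OF bounded_bilinear_herm]
        has_derivative_continuous_on[OF has_derivative_lift_vec_1])
  then show ?thesis unfolding CH_def
    using open_Collect_less[OF _ continuous_on_const] by blast
qed

lemma
  shows base_pt_nth: "base_pt p $ j = (if j = p then - 1 else 0)"
    and herm_base_base: "herm p (lift_vec 1 (base_pt p)) (lift_vec 1 (base_pt p)) = - 2"
    and herm_tangent_base: "herm p (lift_vec 0 u) (lift_vec 1 (base_pt p)) = u $ p"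
    and herm_base_tangent: "herm p (lift_vec 1 (base_pt p)) (lift_vec 0 u) = cnj (u $ p)"
    and herm_tangent_tangent: "herm p (lift_vec 0 u) (lift_vec 0 w) = herm1 p u w"
  by (simp_all add: herm_def herm1_def lift_vec_def base_pt_def axis_def)

lemma base_pt_in_CH: "base_pt p \<in> CH p"
  by (simp add: CH_def herm_base_base)

lemma CH_metric_base_pt_herm1:
  "CH_metric \<mu> p (base_pt p) u w = \<mu> * (Re (herm1 p u w) / 2 + Re (u $ p * cnj (w $ p)) / 4)"
  unfolding CH_metric_def Let_def herm_base_base herm_tangent_base herm_base_tangent herm_tangent_tangent
  by simp

lemma herm1_add_left: "herm1 p (u + v) w = herm1 p u w + herm1 p v w"
  and herm1_add_right: "herm1 p w (u + v) = herm1 p w u + herm1 p w v"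
  and herm1_scale_left: "herm1 p (c *s u) w = c * herm1 p u w"
  and herm1_scale_right: "herm1 p w (c *s u) = cnj c * herm1 p w u"
  and herm1_cnj: "cnj (herm1 p u w) = herm1 p w u"
  by (simp_all add: herm1_def sum.distrib sum_distrib_left algebra_simps)

lemma herm1_scaleR_left: "herm1 p (c *\<^sub>R u) w = c *\<^sub>R herm1 p u w"
  by (simp add: herm1_def scaleR_sum_right)

lemma CH_metric_base_pt_sym: "CH_metric \<mu> p (base_pt p) u w = CH_metric \<mu> p (base_pt p) w u"
  unfolding CH_metric_base_pt_herm1 herm1_cnj[of p w u, symmetric] by simp

lemma linear_CH_metric_base_pt: "linear (\<lambda>u. CH_metric \<mu> p (base_pt p) u w)"
  by (rule linearI) (simp_all add: CH_metric_base_pt_herm1 herm1_add_left herm1_scaleR_left field_simps)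

text \<open>Positive definiteness at the base point; this is what makes the definite description of
  J unique.\<close>

lemma CH_metric_base_pt_eq_0:
  assumes "\<mu> > 0" "CH_metric \<mu> p (base_pt p) u u = 0"
  shows "u = 0"
proof -
  have "Re (herm1 p u u) = (\<Sum>k\<in>-{p}. (norm (u $ k))\<^sup>2)"
    by (simp add: herm1_def cmod_power2) (simp add: power2_eq_square)
  moreover have "Re (u $ p * cnj (u $ p)) = (norm (u $ p))\<^sup>2"
    by (simp add: cmod_power2) (simp add: power2_eq_square)
  ultimately have "(\<Sum>k\<in>-{p}. (norm (u $ k))\<^sup>2) / 2 + (norm (u $ p))\<^sup>2 / 4 = 0"
    using assms by (simp add: CH_metric_base_pt_herm1)
  moreover have "(\<Sum>k\<in>-{p}. (norm (u $ k))\<^sup>2) \<ge> 0" by (simp add: sum_nonneg)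
  ultimately have "(\<Sum>k\<in>-{p}. (norm (u $ k))\<^sup>2) = 0" "(norm (u $ p))\<^sup>2 = 0"
    using zero_le_power2[of "norm (u $ p)"] by linarith+
  then have "u $ k = 0" for k by (cases "k = p") (auto simp: sum_nonneg_eq_0_iff)
  then show ?thesis by (simp add: vec_eq_iff)
qed

text \<open>The metric has Kaehler potential -\<mu> log(-h(Z, Z)), whose Christoffel symbols in this
  chart are -(h(U, Z) v + h(V, Z) u) / h(Z, Z). At the base point h(Z, Z) = -2 and h(U, Z) is the
  component of u at \<open>p\<close>, which gives this expression.\<close>

definition christoffel :: "'n::finite \<Rightarrow> complex^'n \<Rightarrow> complex^'n \<Rightarrow> complex^'n" where
  "christoffel p u v = (1 / 2) *s (u $ p *s v + v $ p *s u)"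

lemma CH_metric_has_derivative:
  "((\<lambda>x. CH_metric \<mu> p x v w) has_derivative
     (\<lambda>u. CH_metric \<mu> p (base_pt p) (christoffel p u v) w + CH_metric \<mu> p (base_pt p) v (christoffel p u w)))
   (at (base_pt p))"
proof -
  note l = has_derivative_lift_vec_1
  note h' = bounded_bilinear.FDERIV[OF bounded_bilinear_herm]
  let ?Z = "lift_vec 1 (base_pt p)" and ?V = "lift_vec 0 v" and ?W = "lift_vec 0 w"
  define dh where "dh u = u $ p + cnj (u $ p)" for u
  have "((\<lambda>x. herm p (lift_vec 1 x) (lift_vec 1 x)) has_derivative
      (\<lambda>u. herm p ?Z (lift_vec 0 u) + herm p (lift_vec 0 u) ?Z)) (at (base_pt p))"
    by (rule h'[OF l l])
  then have h3: "((\<lambda>x. herm p (lift_vec 1 x) (lift_vec 1 x)) has_derivative dh) (at (base_pt p))"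
    by (simp add: herm_tangent_base herm_base_tangent dh_def[abs_def] add.commute)
  have "((\<lambda>x. herm p ?V (lift_vec 1 x)) has_derivative
      (\<lambda>u. herm p ?V (lift_vec 0 u) + herm p 0 ?Z)) (at (base_pt p))"
    by (rule h'[OF has_derivative_const l])
  then have h1: "((\<lambda>x. herm p ?V (lift_vec 1 x)) has_derivative (\<lambda>u. herm1 p v u)) (at (base_pt p))"
    by (simp add: herm_tangent_tangent bounded_bilinear.zero_left[OF bounded_bilinear_herm])
  have "((\<lambda>x. herm p (lift_vec 1 x) ?W) has_derivative
      (\<lambda>u. herm p ?Z 0 + herm p (lift_vec 0 u) ?W)) (at (base_pt p))"
    by (rule h'[OF l has_derivative_const])
  then have h2: "((\<lambda>x. herm p (lift_vec 1 x) ?W) has_derivative (\<lambda>u. herm1 p u w)) (at (base_pt p))"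
    by (simp add: herm_tangent_tangent bounded_bilinear.zero_right[OF bounded_bilinear_herm])
  \<comment> \<open>The quarters come from h = h(Z, Z) = -2: here 1/h^2 = 1/4, d(-1/h) = dh/h^2 =
    dh/4 and d(1/h^2) = -2 dh/h^3 = dh/4.\<close>
  have "((\<lambda>x. \<mu> * Re (- herm p ?V ?W / herm p (lift_vec 1 x) (lift_vec 1 x)
      + herm p ?V (lift_vec 1 x) * herm p (lift_vec 1 x) ?W / (herm p (lift_vec 1 x) (lift_vec 1 x))\<^sup>2))
    has_derivative (\<lambda>u. \<mu> * Re (herm1 p v w * dh u / 4 + (v $ p * herm1 p u w + herm1 p v u * cnj (w $ p)) / 4
       + v $ p * cnj (w $ p) * dh u / 4))) (at (base_pt p))"
    by (rule derivative_eq_intros h1 h2 h3 refl | simp add: herm_base_base)+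
      (simp add: fun_eq_iff herm_base_base herm_tangent_base herm_base_tangent herm_tangent_tangent field_simps)
  also have "(\<lambda>u. \<mu> * Re (herm1 p v w * dh u / 4 + (v $ p * herm1 p u w + herm1 p v u * cnj (w $ p)) / 4
       + v $ p * cnj (w $ p) * dh u / 4)) = 
      (\<lambda>u. CH_metric \<mu> p (base_pt p) (christoffel p u v) w + CH_metric \<mu> p (base_pt p) v (christoffel p u w))"
    unfolding CH_metric_base_pt_herm1 christoffel_def herm1_add_left herm1_add_right herm1_scale_left herm1_scale_right
    by (simp add: fun_eq_iff dh_def field_simps)
  finally show ?thesis unfolding CH_metric_def[of \<mu> p x for x] Let_def .
qed

section \<open>Brackets in the solvable algebra\<close>

lemma sum_option:
  fixes p :: "'n::finite"
  shows "(\<Sum>i\<in>UNIV. f i) = f None + (f (Some p) + (\<Sum>k\<in>-{p}. f (Some k)))"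
proof -
  have "(\<Sum>i\<in>UNIV. f i) = f None + (\<Sum>k\<in>UNIV. f (Some k))"
    by (simp add: UNIV_option_conv sum.reindex)
  also have "(\<Sum>k\<in>UNIV. f (Some k)) = f (Some p) + (\<Sum>k\<in>-{p}. f (Some k))"
    by (subst sum.remove[of _ p]) (auto simp: Compl_eq_Diff_UNIV)
  finally show ?thesis .
qed

text \<open>One premise for each of the nine blocks in the decomposition n - 1, 1, 1, so that the
  case distinctions in the entries are resolved before the sums are simplified.\<close>

lemma mat_option_eqI:
  fixes p :: "'n::finite" and X Y :: "complex^('n option)^('n option)"
  assumes "X $ None $ None = Y $ None $ None" "X $ None $ Some p = Y $ None $ Some p"
    "X $ Some p $ None = Y $ Some p $ None" "X $ Some p $ Some p = Y $ Some p $ Some p"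
    "\<And>k. k \<noteq> p \<Longrightarrow> X $ None $ Some k = Y $ None $ Some k"
    "\<And>k. k \<noteq> p \<Longrightarrow> X $ Some k $ None = Y $ Some k $ None"
    "\<And>k. k \<noteq> p \<Longrightarrow> X $ Some p $ Some k = Y $ Some p $ Some k"
    "\<And>k. k \<noteq> p \<Longrightarrow> X $ Some k $ Some p = Y $ Some k $ Some p"
    "\<And>k l. k \<noteq> p \<Longrightarrow> l \<noteq> p \<Longrightarrow> X $ Some k $ Some l = Y $ Some k $ Some l"
  shows "X = Y"
proof -
  have "X $ i $ j = Y $ i $ j" for i j
    using assms by (cases i; cases j; metis)
  then show ?thesis by (simp add: vec_eq_iff)
qed

lemma A0_nth: "A0 p $ i $ j = (if i = j then if i = Some p then 1 else if i = None then - 1 else 0 else 0)"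
  by (auto simp: A0_def diag3_def split: option.splits)

lemma N2_nth: "N2 p $ i $ j = (if i = Some p \<and> j = None then \<i> else 0)"
  by (simp add: N2_def)

lemma n1_mat_nth:
  "n1_mat p v $ None $ j = 0"
  "n1_mat p v $ Some k $ None = (if k = p then 0 else v $ k)"
  "n1_mat p v $ Some k $ Some l = (if k = p \<and> l \<noteq> p then - cnj (v $ l) else 0)"
  by (simp_all add: n1_mat_def)

lemma diag3_nth:
  "diag3 p B b c $ None $ None = c" "diag3 p B b c $ None $ Some l = 0" "diag3 p B b c $ Some k $ None = 0"
  "diag3 p B b c $ Some k $ Some l =
     (if k = p \<and> l = p then b else if k = p \<or> l = p then 0 else B $ k $ l)"
  by (simp_all add: diag3_def)

lemma mult_nth:
  fixes p :: "'n::finite" and X Y :: "complex^('n option)^('n option)"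
  shows "(X ** Y) $ i $ j = X $ i $ None * Y $ None $ j + (X $ i $ Some p * Y $ Some p $ j
    + (\<Sum>k\<in>-{p}. X $ i $ Some k * Y $ Some k $ j))"
  by (simp add: matrix_matrix_mult_def sum_option[of _ p])

lemma sum_delta_Compl: "(\<Sum>k\<in>-{p}. if k = l then f k else 0) = (if l = p then 0 else f l)"
  for p :: "'n::finite" and f :: "'n \<Rightarrow> complex"
  by (simp add: sum.delta)

text \<open>\<open>A0 p\<close> is diagonal with eigenvalue 1 at \<open>Some p\<close>, -1 at
  \<open>None\<close> and 0 elsewhere, so commuting with it kills all entries between different
  eigenspaces. Commuting with \<open>N2 p\<close>, which links \<open>None\<close> to
  \<open>Some p\<close>, equates the two remaining scalars; hence K preserves the line of the base
  point.\<close>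

lemma centralizer_nth:
  fixes p :: "'n::finite"
  assumes "K \<in> centralizer {A0 p, N2 p}"
  shows "k \<noteq> p \<Longrightarrow> K $ Some k $ None = 0" "k \<noteq> p \<Longrightarrow> K $ Some k $ Some p = 0"
    "k \<noteq> p \<Longrightarrow> K $ None $ Some k = 0" "k \<noteq> p \<Longrightarrow> K $ Some p $ Some k = 0"
    "K $ Some p $ None = 0" "K $ None $ Some p = 0" "K $ Some p $ Some p = K $ None $ None"
proof -
  have A: "(K ** A0 p) $ i $ j = (A0 p ** K) $ i $ j" and N: "(K ** N2 p) $ i $ j = (N2 p ** K) $ i $ j" for i j
    using assms by (auto simp: centralizer_def)
  have r: "(K ** A0 p) $ i $ j = K $ i $ j * A0 p $ j $ j" for i j
  proof -
    have "(K ** A0 p) $ i $ j = (\<Sum>l\<in>UNIV. if l = j then K $ i $ j * A0 p $ j $ j else 0)"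
      unfolding matrix_matrix_mult_def vec_lambda_beta by (intro sum.cong refl) (simp add: A0_nth)
    then show ?thesis by simp
  qed
  have l: "(A0 p ** K) $ i $ j = A0 p $ i $ i * K $ i $ j" for i j
  proof -
    have "(A0 p ** K) $ i $ j = (\<Sum>l\<in>UNIV. if l = i then A0 p $ i $ i * K $ i $ j else 0)"
      unfolding matrix_matrix_mult_def vec_lambda_beta by (intro sum.cong refl) (simp add: A0_nth)
    then show ?thesis by simp
  qed
  have A': "K $ i $ j * A0 p $ j $ j = A0 p $ i $ i * K $ i $ j" for i j
    using A r l by metis
  show "k \<noteq> p \<Longrightarrow> K $ Some k $ None = 0" "k \<noteq> p \<Longrightarrow> K $ Some k $ Some p = 0"
    "k \<noteq> p \<Longrightarrow> K $ None $ Some k = 0" "k \<noteq> p \<Longrightarrow> K $ Some p $ Some k = 0"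
    "K $ Some p $ None = 0" "K $ None $ Some p = 0"
    using A'[of "Some k" None] A'[of "Some k" "Some p"] A'[of None "Some k"] A'[of "Some p" "Some k"]
      A'[of "Some p" None] A'[of None "Some p"] by (auto simp: A0_nth)
  show "K $ Some p $ Some p = K $ None $ None"
    using N[of "Some p" None] by (simp add: mult_nth[of _ _ _ _ p] N2_nth)
qed

lemma su_u1_subset_centralizer: "su_u1 p \<subseteq> centralizer {A0 p, N2 p}"
proof
  fix E assume "E \<in> su_u1 p"
  then obtain F c where E: "E = diag3 p F c c" by (auto simp: su_u1_def)
  have "E ** A0 p = A0 p ** E"
    by (rule mat_option_eqI[where p = p]) (simp_all add: E mult_nth[of _ _ _ _ p] diag3_nth A0_nth
        if_distrib[of "\<lambda>x. y * x" for y] if_distrib[of "\<lambda>x. x * y" for y] sum_delta_Compl cong: if_cong)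
  moreover have "E ** N2 p = N2 p ** E"
    by (rule mat_option_eqI[where p = p]) (simp_all add: E mult_nth[of _ _ _ _ p] diag3_nth N2_nth)
  ultimately show "E \<in> centralizer {A0 p, N2 p}" by (simp add: centralizer_def)
qed

lemma n1_mat_cong: "(\<And>k. k \<noteq> p \<Longrightarrow> v $ k = w $ k) \<Longrightarrow> n1_mat p v = n1_mat p w"
  by (auto simp: n1_mat_nth intro!: mat_option_eqI[where p = p])

lemma linear_n1_mat: "linear (n1_mat p)"
  by (auto intro!: linearI mat_option_eqI[where p = p] simp: n1_mat_nth)

lemma subspace_nil1: "subspace (nil1 p)"
  unfolding nil1_def using linear_subspace_image[OF linear_n1_mat subspace_UNIV] .

lemma subspace_nilp: "subspace (nilp p)"
proof -
  have "nilp p = {x + y | x y. x \<in> nil1 p \<and> y \<in> span {N2 p}}"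
    by (auto simp: nilp_def span_singleton)
  then show ?thesis using subspace_sums[OF subspace_nil1 subspace_span] by simp
qed

lemma n1_mat_in_nilp: "n1_mat p v \<in> nilp p"
  and N2_in_nilp: "N2 p \<in> nilp p"
proof -
  have "n1_mat p v = n1_mat p v + 0 *\<^sub>R N2 p" by simp
  then show "n1_mat p v \<in> nilp p" unfolding nilp_def nil1_def by blast
  have "N2 p = n1_mat p 0 + 1 *\<^sub>R N2 p" by (simp add: linear_0[OF linear_n1_mat])
  then show "N2 p \<in> nilp p" unfolding nilp_def nil1_def by blast
qed

text \<open>The bracket acts on v by F - ic. That F is skew-Hermitian makes the row of the bracket
  match its column, as the shape of \<open>n1_mat\<close> demands.\<close>

lemma comm_su_u1_nil1:
  assumes "E \<in> su_u1 p"
  shows "comm E (n1_mat p v) \<in> nil1 p"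
proof -
  obtain F c where E: "E = diag3 p F (\<i> * of_real c) (\<i> * of_real c)"
    and F: "\<And>k l. k \<noteq> p \<Longrightarrow> l \<noteq> p \<Longrightarrow> F $ k $ l = - cnj (F $ l $ k)"
    using assms by (auto simp: su_u1_def)
  have F': "cnj (F $ k $ l) = - F $ l $ k" if "k \<noteq> p" "l \<noteq> p" for k l
    using F[OF that(2,1)] by simp
  have "comm E (n1_mat p v) = n1_mat p (\<chi> j. (\<Sum>l\<in>-{p}. F $ j $ l * v $ l) - \<i> * of_real c * v $ j)"
    by (rule mat_option_eqI[where p = p])
      (auto simp: comm_def E mult_nth[of _ _ _ _ p] diag3_nth n1_mat_nth F' sum_negf sum_distrib_left algebra_simps
        cong: sum.cong_simp)
  then show ?thesis by (auto simp: nil1_def)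
qed

lemma comm_A0_n1_mat: "comm (A0 p) (n1_mat p v) = n1_mat p v"
  by (rule mat_option_eqI[where p = p]) (auto simp: comm_def mult_nth[of _ _ _ _ p] A0_nth n1_mat_nth
      if_distrib[of "\<lambda>x. _ * x"] if_distrib[of "\<lambda>x. x * _"] sum_delta_Compl cong: if_cong)

lemma comm_A0_N2: "comm (A0 p) (N2 p) = 2 *\<^sub>R N2 p"
  by (rule mat_option_eqI[where p = p]) (auto simp: comm_def mult_nth[of _ _ _ _ p] A0_nth N2_nth
      scaleR_conv_of_real[where 'a=complex])

lemma comm_N2_n1_mat: "comm (N2 p) (n1_mat p v) = 0"
  by (rule mat_option_eqI[where p = p]) (auto simp: comm_def mult_nth[of _ _ _ _ p] n1_mat_nth N2_nth)

lemma comm_n1_mat: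
  "comm (n1_mat p v) (n1_mat p w) = (2 * Im (herm1 p v w)) *\<^sub>R N2 p"
proof -
  define r where "r = 2 * Im (herm1 p v w)"
  have "r *\<^sub>R \<i> = herm1 p v w - herm1 p w v"
    unfolding herm1_cnj[of p v w, symmetric] by (simp add: complex_eq_iff r_def)
  then have "comm (n1_mat p v) (n1_mat p w) = r *\<^sub>R N2 p"
    by (intro mat_option_eqI[where p = p]) (simp_all add: comm_def mult_nth[of _ _ _ _ p] n1_mat_nth N2_nth
      herm1_def sum_negf mult.commute)
  then show ?thesis by (simp add: r_def)
qed

lemma comm_add_left: "comm (X + Y) Z = comm X Z + comm Y Z"
  and comm_add_right: "comm Z (X + Y) = comm Z X + comm Z Y"
  and comm_scaleR_left: "comm (r *\<^sub>R X) Z = r *\<^sub>R comm X Z"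
  and comm_scaleR_right: "comm Z (r *\<^sub>R X) = r *\<^sub>R comm Z X"
  and comm_self: "comm X X = 0"
  and comm_swap: "comm X Y = - comm Y X"
  by (simp_all add: comm_def mmul.add_left mmul.add_right mmul.scaleR_left mmul.scaleR_right scaleR_diff_right)

lemma comm_centralizer: "K \<in> centralizer S \<Longrightarrow> M \<in> S \<Longrightarrow> comm K M = 0"
  by (simp add: centralizer_def comm_def)

lemma nilp_cases:
  assumes "X \<in> nilp p"
  obtains v e where "X = n1_mat p v + e *\<^sub>R N2 p"
  using assms by (auto simp: nilp_def nil1_def)

lemma comm_nilp:
  assumes "X \<in> nilp p" "Y \<in> nilp p"
  shows "comm X Y \<in> nilp p"
proof -
  obtain v e w f where X: "X = n1_mat p v + e *\<^sub>R N2 p" and Y: "Y = n1_mat p w + f *\<^sub>R N2 p"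
    using assms nilp_cases by metis
  have "comm (n1_mat p v) (N2 p) = 0" using comm_swap comm_N2_n1_mat by (metis neg_equal_0_iff_equal)
  then have "comm X Y = (2 * Im (herm1 p v w)) *\<^sub>R N2 p"
    unfolding X Y comm_add_left comm_add_right comm_scaleR_left comm_scaleR_right comm_n1_mat comm_N2_n1_mat comm_self
    by simp
  then show ?thesis using subspace_scale[OF subspace_nilp N2_in_nilp] by simp
qed

lemma comm_A0_su_u1_nilp:
  assumes "E \<in> su_u1 p" "X \<in> nilp p"
  shows "comm (A0 p + E) X \<in> nilp p"
proof -
  obtain v e where X: "X = n1_mat p v + e *\<^sub>R N2 p" using assms(2) nilp_cases by metis
  have "comm E (N2 p) = 0" using comm_centralizer su_u1_subset_centralizer assms(1) by blast
  moreover have "comm E (n1_mat p v) \<in> nilp p"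
    using comm_su_u1_nil1[OF assms(1)] n1_mat_in_nilp by (metis nil1_def rangeE)
  ultimately show ?thesis
    unfolding X comm_add_left comm_add_right comm_scaleR_right comm_A0_N2 comm_A0_n1_mat
    by (auto intro!: subspace_add[OF subspace_nilp] subspace_scale[OF subspace_nilp] n1_mat_in_nilp N2_in_nilp)
qed

section \<open>Generators of the solvable algebra at the base point\<close>

lemma base_mult: "(M *v lift_vec 1 (base_pt p)) $ i = M $ i $ None - M $ i $ Some p"
  for M :: "complex^('n option)^('n::finite option)"
  unfolding matrix_vector_mult_def by (simp add: sum_option[of _ p] lift_vec_def base_pt_nth)

lemma tangent_mult: "(M *v lift_vec 0 c) $ i = M $ i $ Some p * c $ p + (\<Sum>k\<in>-{p}. M $ i $ Some k * c $ k)"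
  for M :: "complex^('n option)^('n::finite option)"
  unfolding matrix_vector_mult_def by (simp add: sum_option[of _ p] lift_vec_def)

lemma gen_centralizer:
  assumes "K \<in> centralizer {A0 p, N2 p}"
  shows "gen K (base_pt p) = 0"
  unfolding gen_formula base_mult
  by (auto simp: vec_eq_iff base_pt_nth centralizer_nth[OF assms])

text \<open>This is the linear isotropy action of K. It annihilates the \<open>p\<close>-direction,
  spanned by the velocities of A_0 and N_2, and so depends only on the \<nn>_1-part of c.\<close>

lemma gen_deriv_centralizer:
  assumes "K \<in> centralizer {A0 p, N2 p}"
  shows "gen_deriv K (base_pt p) c =
    (\<chi> j. if j = p then 0 else (\<Sum>l\<in>-{p}. K $ Some j $ Some l * c $ l) - K $ None $ None * c $ j)"
  unfolding gen_deriv_def base_mult tangent_mult[of _ _ _ p]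
  by (auto simp: vec_eq_iff base_pt_nth centralizer_nth[OF assms] algebra_simps cong: sum.cong_simp)

text \<open>Velocity at the base point of a A_0 + e N_2 + X with X given by v. The factor 2 arises
  since exp(tA_0) scales the \<open>p\<close>-coordinate, here -1, by e^(2t).\<close>

definition tangent_vec :: "'n::finite \<Rightarrow> real \<Rightarrow> real \<Rightarrow> complex^'n \<Rightarrow> complex^'n" where
  "tangent_vec p a e v = (\<chi> j. if j = p then \<i> * of_real e - of_real (2 * a) else v $ j)"

lemma gen_sol:
  "gen (a *\<^sub>R A0 p + e *\<^sub>R N2 p + n1_mat p v) (base_pt p) = tangent_vec p a e v"
proof -
  have "(0 :: complex^('a option)^('a option)) \<in> su_u1 p"
  proof -
    have "(0 :: complex^('a option)^('a option)) = diag3 p 0 (\<i> * of_real 0) (\<i> * of_real 0)"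
      by (rule mat_option_eqI[where p = p]) (auto simp: diag3_nth)
    then show ?thesis unfolding su_u1_def by (intro CollectI exI[of _ 0] conjI) auto
  qed
  from gen_base_pt[OF this, of a e v] show ?thesis by (simp add: tangent_vec_def)
qed

lemma gen_deriv_sol:
  "gen_deriv (a *\<^sub>R A0 p + e *\<^sub>R N2 p + n1_mat p v) (base_pt p) c
    = (\<chi> j. if j = p then 2 * of_real a * c $ p - herm1 p c v else of_real a * c $ j)"
  unfolding gen_deriv_def base_mult tangent_mult[of _ _ _ p]
  by (auto simp: vec_eq_iff base_pt_nth A0_nth N2_nth n1_mat_nth scaleR_conv_of_real[where 'a=complex]
     herm1_def sum_negf algebra_simps cong: sum.cong_simp)

lemma tangent_vec_inject:
  assumes "tangent_vec p a e v = tangent_vec p a' e' v'"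
  shows "a = a'" "e = e'" "n1_mat p v = n1_mat p v'"
proof -
  have *: "tangent_vec p a e v $ j = tangent_vec p a' e' v' $ j" for j using assms by simp
  show "a = a'" "e = e'" using *[of p] by (simp_all add: tangent_vec_def complex_eq_iff)
  show "n1_mat p v = n1_mat p v'"
  proof (rule n1_mat_cong)
    fix k assume "k \<noteq> p"
    then show "v $ k = v' $ k" using *[of k] by (simp add: tangent_vec_def)
  qed
qed

text \<open>In coordinates these are the rules J A_0 = -2 N_2 and J N_2 = A_0 / 2; in particular the
  \<alpha>-coordinate of JB is half the \<eta>-coordinate of B.\<close>

lemma i_tangent_vec: "\<i> *s tangent_vec p a e v = tangent_vec p (e / 2) (- 2 * a) (\<i> *s v)"
  by (simp add: vec_eq_iff tangent_vec_def algebra_simps)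

text \<open>The first term is the contribution of the Levi-Civita connection, the second one that of the
  canonical connection; the summand of the second one in the isotropy algebra is left out.\<close>

lemma structure_tensor_identity:
  fixes p :: "'n::finite" and \<mu> :: real
  defines "z \<equiv> tangent_vec p"
    and "g \<equiv> CH_metric \<mu> p (base_pt p)"
  assumes "b = z aB eB vB" "c = z aC eC vC" "d = z aD eD vD"
  shows "g (christoffel p b c) d
      + g (gen_deriv (aB *\<^sub>R A0 p + eB *\<^sub>R N2 p + n1_mat p vB) (base_pt p) c) d
    = aD * g b c - aC * g b d + eD / 2 * g b (\<i> *s c) - eC / 2 * g b (\<i> *s d)
      - eB / 2 * g (z 0 0 vC) (\<i> *s z 0 0 vD)"
proof -
  have h: "herm1 p (\<chi> j. if j = p then x else u j) w = herm1 p (\<chi> j. u j) w"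
    "herm1 p w (\<chi> j. if j = p then x else u j) = herm1 p w (\<chi> j. u j)" for x u w
    by (auto simp: herm1_def intro!: sum.cong)
  \<comment> \<open>Once every \<open>herm1\<close> is expressed through these three numbers, both
    sides are real parts of polynomials in them, their conjugates and the six real coordinates, and
    normalisation closes the goal.\<close>
  define P Q R where "P = herm1 p vB vC" and "Q = herm1 p vB vD" and "R = herm1 p vC vD"
  have P: "herm1 p vC vB = cnj P" by (simp add: P_def herm1_cnj)
  have bcd: "b $ p = \<i> * of_real eB - of_real (2 * aB)" "c $ p = \<i> * of_real eC - of_real (2 * aC)"
    "d $ p = \<i> * of_real eD - of_real (2 * aD)" "z 0 0 v $ p = 0" for v
    by (simp_all add: assms tangent_vec_def)
  have hz: "herm1 p (z a e v) w = herm1 p v w" "herm1 p w (z a e v) = herm1 p w v" for a e v w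
    by (simp_all add: z_def tangent_vec_def h)
  have hb: "herm1 p b w = herm1 p vB w" "herm1 p c w = herm1 p vC w" "herm1 p w c = herm1 p w vC"
    "herm1 p w d = herm1 p w vD" for w by (simp_all add: assms(3-5) hz)
  define G where "G = gen_deriv (aB *\<^sub>R A0 p + eB *\<^sub>R N2 p + n1_mat p vB) (base_pt p) c"
  have G: "herm1 p G vD = of_real aB * R"
  proof -
    have "(\<chi> j. of_real aB * c $ j) = of_real aB *s c" by (simp add: vec_eq_iff)
    then show ?thesis unfolding G_def gen_deriv_sol h by (simp add: herm1_scale_left hb R_def)
  qed
  have Gp: "G $ p = 2 * of_real aB * c $ p - cnj P"
    by (simp add: G_def gen_deriv_sol hb P)
  show ?thesis
    unfolding g_def CH_metric_base_pt_herm1 christoffel_def herm1_add_left herm1_scale_left herm1_scale_right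
      hb hz G_def[symmetric]
    unfolding G Gp P_def[symmetric] Q_def[symmetric] R_def[symmetric]
    by (simp add: bcd field_simps)
qed

section \<open>Homogeneous descriptions\<close>

lemma lie_algebra_grpH_subset: "lie_algebra (grpH p Fr) \<subseteq> centralizer {A0 p, N2 p}"
proof -
  have "lie_algebra (grpH p Fr) \<subseteq> lie_algebra (SU_U1 p)"
    by (auto simp: lie_algebra_def grpH_def)
  also have "\<dots> \<subseteq> centralizer {A0 p, N2 p}"
    unfolding SU_U1_def by (rule lie_algebra_group_span_subset[OF su_u1_subset_centralizer])
  finally show ?thesis .
qed

text \<open>Split B and C into parts in \<open>sol_r\<close> and in \<hh>. Brackets with \<hh> are
  handled by differentiating the invariance of \<mm> and \<hh> under \<open>Ad(H)\<close>. Brackets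
  inside \<open>sol_r\<close> fall into \<nn>, because \<aa>_r is one-dimensional and A_0 + H_r
  normalises \<nn>.\<close>

lemma comm_in_lie_algebra:
  assumes Fr: "nonsymmetric_Fr p Fr"
    and m: "reductive_decomposition (grpG p Fr) (grpH p Fr) \<mm>"
    and Hr: "Hr \<in> su_u1 p" "alg_a_r p Fr = span {A0 p + Hr}"
    and phir: "\<forall>X\<in>sol_r p Fr. phir X \<in> lie_algebra (grpH p Fr)"
      "\<mm> = {X + phir X | X. X \<in> sol_r p Fr}"
    and BC: "B \<in> \<mm>" "C \<in> \<mm>"
  shows "comm B C \<in> lie_algebra (grpG p Fr)"
proof -
  let ?\<gg> = "lie_algebra (grpG p Fr)" and ?\<hh> = "lie_algebra (grpH p Fr)"
  have sub: "subspace ?\<hh>" "subspace \<mm>" and \<gg>: "?\<gg> = {X + Y | X Y. X \<in> ?\<hh> \<and> Y \<in> \<mm>}"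
    and Ad: "\<And>a X. a \<in> grpH p Fr \<Longrightarrow> X \<in> \<mm> \<Longrightarrow> a ** X ** matrix_inv a \<in> \<mm>"
    using m by (auto simp: reductive_decomposition_def)
  have sub\<gg>: "subspace ?\<gg>" unfolding \<gg> using sub by (rule subspace_sums)
  have \<hh>\<gg>: "X \<in> ?\<gg>" if "X \<in> ?\<hh>" for X
    using that subspace_0[OF sub(2)] unfolding \<gg> by (force intro: exI[of _ X] exI[of _ 0])
  have \<mm>\<gg>: "X \<in> ?\<gg>" if "X \<in> \<mm>" for X
    using that subspace_0[OF sub(1)] unfolding \<gg> by (force intro: exI[of _ X] exI[of _ 0])
  have grp: "matrix_group Fr" using Fr by (simp add: nonsymmetric_Fr_def Let_def)
  then have "matrix_group (grpH p Fr)"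
    unfolding grpH_def SU_U1_def by (rule matrix_group_Int_group_span)
  then have Ad\<hh>: "a ** X ** matrix_inv a \<in> ?\<hh>" if "a \<in> grpH p Fr" "X \<in> ?\<hh>" for a X
    using that by (intro lie_algebra_Ad)
  \<comment> \<open>\<open>N\<close> is contained in \<open>G\<close> because \<open>Fr\<close>
    contains the identity.\<close>
  have nilp: "X \<in> ?\<gg>" if "X \<in> nilp p" for X
  proof -
    have "mexp (t *\<^sub>R X) \<in> grpG p Fr" for t
    proof -
      have "mexp (t *\<^sub>R X) \<in> grpN p" using subspace_scale[OF subspace_nilp that] by (auto simp: grpN_def)
      moreover have "mat 1 \<in> Fr" using grp by (simp add: matrix_group_def)
      ultimately have "mat 1 ** mexp (t *\<^sub>R X) \<in> grpG p Fr" unfolding grpG_def by blast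
      then show ?thesis by simp
    qed
    then show ?thesis by (simp add: lie_algebra_def)
  qed
  have sol_r: "\<exists>r. \<exists>Z\<in>nilp p. X = r *\<^sub>R (A0 p + Hr) + Z" if "X \<in> sol_r p Fr" for X
    using that unfolding sol_r_def Hr(2) by (auto simp: span_singleton)
  have comm_sol_r: "comm X Y \<in> ?\<gg>" if XY: "X \<in> sol_r p Fr" "Y \<in> sol_r p Fr" for X Y
  proof -
    obtain r Z s W where X: "X = r *\<^sub>R (A0 p + Hr) + Z" "Z \<in> nilp p"
      and Y: "Y = s *\<^sub>R (A0 p + Hr) + W" "W \<in> nilp p" using sol_r XY by metis
    have "comm X Y = r *\<^sub>R comm (A0 p + Hr) W - s *\<^sub>R comm (A0 p + Hr) Z + comm Z W"
      unfolding X Y comm_add_left[of "r *\<^sub>R _"] comm_add_right[of _ "s *\<^sub>R _"] comm_scaleR_left comm_scaleR_right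
        comm_self comm_swap[of Z "A0 p + Hr"] by simp
    moreover have "\<dots> \<in> nilp p"
      using X(2) Y(2) Hr(1) by (intro subspace_add[OF subspace_nilp] subspace_diff[OF subspace_nilp]
          subspace_scale[OF subspace_nilp] comm_A0_su_u1_nilp comm_nilp)
    ultimately show ?thesis using nilp by simp
  qed
  obtain X Y where X: "X \<in> sol_r p Fr" "B = X + phir X" and Y: "Y \<in> sol_r p Fr" "C = Y + phir Y"
    using BC phir(2) by blast
  have K: "phir X \<in> ?\<hh>" "phir Y \<in> ?\<hh>" using phir(1) X Y by auto
  have "comm (phir X) C \<in> ?\<gg>" "comm (phir Y) B \<in> ?\<gg>" "comm (phir X) (phir Y) \<in> ?\<gg>"
    using comm_mem_of_Ad_invariant[OF K(1) sub(2) BC(2) Ad] comm_mem_of_Ad_invariant[OF K(2) sub(2) BC(1) Ad]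
      comm_mem_of_Ad_invariant[OF K(1) sub(1) K(2) Ad\<hh>] by (auto intro: \<hh>\<gg> \<mm>\<gg>)
  \<comment> \<open>The brackets are grouped with whole elements of \<mm>, since invariance concerns
    \<mm> and not \<open>sol_r\<close>; [\<open>phir X\<close>, \<open>phir Y\<close>] is then
    counted twice and subtracted once.\<close>
  moreover have "comm B C = comm (phir X) C - comm (phir Y) B - comm (phir X) (phir Y) + comm X Y"
    unfolding comm_swap[of "phir Y" B] unfolding X(2) Y(2) comm_add_left comm_add_right by simp
  ultimately show ?thesis
    using comm_sol_r[OF X(1) Y(1)] by (simp add: subspace_add[OF sub\<gg>] subspace_diff[OF sub\<gg>])
qed

text \<open>The discarded component lies in \<hh> and its generator vanishes at the base point. The
  normalisation of the canonical connection can therefore be read with the full bracket.\<close>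

lemma gen_m_part:
  assumes "reductive_decomposition (grpG p Fr) (grpH p Fr) \<mm>" "X \<in> lie_algebra (grpG p Fr)"
  shows "gen (m_part (lie_algebra (grpH p Fr)) \<mm> X) (base_pt p) = gen X (base_pt p)"
proof -
  let ?\<hh> = "lie_algebra (grpH p Fr)"
  have sub: "subspace ?\<hh>" "subspace \<mm>" and int: "?\<hh> \<inter> \<mm> = {0}"
    using assms(1) by (auto simp: reductive_decomposition_def)
  obtain K Y where KY: "K \<in> ?\<hh>" "Y \<in> \<mm>" "X = K + Y"
    using assms by (auto simp: reductive_decomposition_def)
  have "m_part ?\<hh> \<mm> X = Y"
    unfolding m_part_def
  proof (rule the_equality)
    show "Y \<in> \<mm> \<and> X - Y \<in> ?\<hh>" using KY by simp
    fix Z assume Z: "Z \<in> \<mm> \<and> X - Z \<in> ?\<hh>"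
    have "Z - Y \<in> \<mm>" using Z KY(2) subspace_diff[OF sub(2)] by blast
    moreover have "(X - Y) - (X - Z) \<in> ?\<hh>"
      by (rule subspace_diff[OF sub(1)]) (use Z KY in simp_all)
    then have "Z - Y \<in> ?\<hh>" by simp
    ultimately have "Z - Y \<in> {0}" unfolding int[symmetric] by (rule IntI[rotated])
    then show "Z = Y" by simp
  qed
  moreover have "gen K (base_pt p) = 0"
    by (rule gen_centralizer[OF subsetD[OF lie_algebra_grpH_subset KY(1)]])
  ultimately show ?thesis using linear_add[OF linear_gen, of K Y "base_pt p"] KY(3) by simp
qed

theorem theorem4p2:
  fixes p :: "'n::finite" and \<mu> :: real
    and Fr \<mm> :: "(complex^('n option)^('n option)) set"
    and Hr :: "complex^('n option)^('n option)"
    and chi phir :: "complex^('n option)^('n option) \<Rightarrow> complex^('n option)^('n option)"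
    and nabla nabla' :: "(complex^'n \<Rightarrow> complex^'n) \<Rightarrow> (complex^'n \<Rightarrow> complex^'n) \<Rightarrow> complex^'n \<Rightarrow> complex^'n"
    and B C D :: "complex^('n option)^('n option)"
    and V W :: "complex^'n \<Rightarrow> complex^'n"
  assumes mu: "\<mu> > 0"
    and Fr: "nonsymmetric_Fr p Fr"
    and m: "reductive_decomposition (grpG p Fr) (grpH p Fr) \<mm>"
    and Hr: "Hr \<in> su_u1 p" "alg_a_r p Fr = span {A0 p + Hr}"
    and chi: "linear_from (sol p) chi" "\<forall>X\<in>nilp p. chi X = X" "chi (A0 p) = A0 p + Hr"
    and phir: "linear_from (sol_r p Fr) phir"
      "\<forall>X\<in>sol_r p Fr. phir X \<in> lie_algebra (grpH p Fr)"
      "\<mm> = {X + phir X | X. X \<in> sol_r p Fr}"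
    and nabla: "levi_civita (CH p) (CH_metric \<mu> p) nabla"
    and nabla': "canonical_connection p (grpG p Fr) (grpH p Fr) \<mm> nabla'"
    and BCD: "B \<in> \<mm>" "C \<in> \<mm>" "D \<in> \<mm>"
    and VW: "smooth_on (CH p) V" "V (base_pt p) = gen B (base_pt p)"
      "smooth_on (CH p) W" "W (base_pt p) = gen C (base_pt p)"
  shows
    "let phi = phir \<circ> chi;
         T = (\<lambda>X. chi X + phi X);
         \<alpha> = alpha_of p T;
         \<eta> = eta_of p T;
         X = X_of p T;
         g = g_o \<mu> p;
         \<omega> = omega_o \<mu> p;
         J = J_o \<mu> p \<mm>;
         B' = \<alpha> B *\<^sub>R phi (A0 p) + \<eta> B *\<^sub>R phi (N2 p) + phi (X B);
         C_r = T (comm Hr (X C));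
         S_B_C = nabla V W (base_pt p) - nabla' V W (base_pt p)
     in CH_metric \<mu> p (base_pt p) S_B_C (gen D (base_pt p)) =
          \<alpha> D * g B C - \<alpha> C * g B D + \<alpha> (J D) * g B (J C) - \<alpha> (J C) * g B (J D)
          - \<alpha> (J B) * \<omega> (T (X C)) (T (X D)) + g (comm B' C) D + \<alpha> B * g C_r D"
proof -
  define \<hh> where "\<hh> = lie_algebra (grpH p Fr)"
  define o' where "o' = base_pt p"
  define g where "g = CH_metric \<mu> p o'"
  define phi where "phi = phir \<circ> chi"
  define T where "T = (\<lambda>X. chi X + phi X)"
  have T_apply: "chi X + phi X = T X" for X by (simp add: T_def)
  let ?Z = "tangent_vec p"
  let ?comb = "\<lambda>a e v. a *\<^sub>R T (A0 p) + e *\<^sub>R T (N2 p) + T (n1_mat p v)"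
  have sub: "subspace \<hh>" "subspace \<mm>"
    using m by (auto simp: reductive_decomposition_def \<hh>_def)
  have \<hh>_cent: "\<hh> \<subseteq> centralizer {A0 p, N2 p}"
    unfolding \<hh>_def by (rule lie_algebra_grpH_subset)
  have Hr_cent: "Hr \<in> centralizer {A0 p, N2 p}" using Hr(1) su_u1_subset_centralizer by blast

  \<comment> \<open>The tilde map \<open>T\<close> onto \<mm>\<close>
  have sol_r: "r *\<^sub>R (A0 p + Hr) + X \<in> sol_r p Fr" if "X \<in> nilp p" for r X
    using that unfolding sol_r_def Hr(2) by (auto simp: span_singleton)
  have sol_r_A: "A0 p + Hr \<in> sol_r p Fr"
    using sol_r[of 0 1] subspace_0[OF subspace_nilp[of p]] by simp
  have sol_r_nilp: "X \<in> sol_r p Fr" if "X \<in> nilp p" for X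
    using sol_r[OF that, of 0] by simp
  have T_A0: "T (A0 p) = A0 p + (Hr + phi (A0 p))" by (simp add: T_def chi)
  have T_nilp: "T X = X + phi X" if "X \<in> nilp p" for X using that chi(2) by (simp add: T_def)
  have phi_A0: "phi (A0 p) = phir (A0 p + Hr)" by (simp add: phi_def chi)
  have phi_nilp: "phi X = phir X" if "X \<in> nilp p" for X using that chi(2) by (simp add: phi_def)
  have phi_A0_\<hh>: "phi (A0 p) \<in> \<hh>" using phir(2) sol_r_A by (simp add: phi_A0 \<hh>_def)
  have phi_nilp_\<hh>: "phi X \<in> \<hh>" if "X \<in> nilp p" for X
    using phir(2) sol_r_nilp[OF that] by (simp add: phi_nilp[OF that] \<hh>_def)

  have T_in: "?comb a e v \<in> \<mm>" for a e v
  proof -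
    have "(A0 p + Hr) + phir (A0 p + Hr) \<in> \<mm>" using sol_r_A unfolding phir(3) by blast
    then have "T (A0 p) \<in> \<mm>" by (simp add: T_A0 phi_A0 add.assoc)
    moreover have "T X \<in> \<mm>" if "X \<in> nilp p" for X
      using sol_r_nilp[OF that] unfolding T_nilp[OF that] phi_nilp[OF that] phir(3) by blast
    ultimately show ?thesis
      by (auto intro!: subspace_add[OF sub(2)] subspace_scale[OF sub(2)] simp: n1_mat_in_nilp N2_in_nilp)
  qed
  have \<mm>_cases: "\<exists>a e v. X = ?comb a e v" if "X \<in> \<mm>" for X
  proof -
    obtain Y where Y: "Y \<in> sol_r p Fr" "X = Y + phir Y" using \<open>X \<in> \<mm>\<close> phir(3) by blast
    then obtain a Z where "Z \<in> nilp p" "Y = a *\<^sub>R (A0 p + Hr) + Z"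
      unfolding sol_r_def Hr(2) by (auto simp: span_singleton)
    then obtain e v where Y': "Y = a *\<^sub>R (A0 p + Hr) + (n1_mat p v + e *\<^sub>R N2 p)"
      using nilp_cases by metis
    have eN: "e *\<^sub>R N2 p \<in> nilp p" by (rule subspace_scale[OF subspace_nilp N2_in_nilp])
    have aA: "a *\<^sub>R (A0 p + Hr) \<in> sol_r p Fr" using sol_r[of 0 a] subspace_0[OF subspace_nilp[of p]] by simp
    have add: "phir (x + y) = phir x + phir y" if "x \<in> sol_r p Fr" "y \<in> sol_r p Fr" for x y
      using phir(1) that by (simp add: linear_from_def)
    have scale: "phir (c *\<^sub>R x) = c *\<^sub>R phir x" if "x \<in> sol_r p Fr" for x c
      using phir(1) that by (simp add: linear_from_def)
    have "phir Y = a *\<^sub>R phir (A0 p + Hr) + (phir (n1_mat p v) + e *\<^sub>R phir (N2 p))"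
      unfolding Y' using aA eN
      by (simp add: add scale sol_r_A sol_r_nilp n1_mat_in_nilp N2_in_nilp subspace_add[OF subspace_nilp]
          del: scaleR_add_right)
    then have "X = ?comb a e v"
      unfolding Y(2) Y' T_A0 phi_A0 T_nilp[OF N2_in_nilp] T_nilp[OF n1_mat_in_nilp]
        phi_nilp[OF N2_in_nilp] phi_nilp[OF n1_mat_in_nilp]
      by (simp add: algebra_simps)
    then show ?thesis by blast
  qed

  \<comment> \<open>Velocities at the base point, coordinates on \<mm> and J\<close>
  have comb: "?comb a e v = (a *\<^sub>R A0 p + e *\<^sub>R N2 p + n1_mat p v)
      + (a *\<^sub>R Hr + (a *\<^sub>R phi (A0 p) + e *\<^sub>R phi (N2 p) + phi (n1_mat p v)))" for a e v
    unfolding T_A0 T_nilp[OF N2_in_nilp] T_nilp[OF n1_mat_in_nilp] by (simp add: algebra_simps)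
  have iso: "a *\<^sub>R phi (A0 p) + e *\<^sub>R phi (N2 p) + phi (n1_mat p v) \<in> \<hh>" for a e v
    by (intro subspace_add[OF sub(1)] subspace_scale[OF sub(1)] phi_A0_\<hh> phi_nilp_\<hh> n1_mat_in_nilp N2_in_nilp)
  \<comment> \<open>\<open>Hr\<close> and all values of \<open>phi\<close> centralize A_0 and N_2,
    so their generators vanish at the base point and only the solvable part contributes.\<close>
  have gen_comb: "gen (?comb a e v) o' = ?Z a e v" for a e v
  proof -
    have "a *\<^sub>R Hr + (a *\<^sub>R phi (A0 p) + e *\<^sub>R phi (N2 p) + phi (n1_mat p v)) \<in> centralizer {A0 p, N2 p}"
      by (rule subspace_add[OF subspace_centralizer subspace_scale[OF subspace_centralizer Hr_cent]
            subsetD[OF \<hh>_cent iso]])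
    then have "gen (a *\<^sub>R Hr + (a *\<^sub>R phi (A0 p) + e *\<^sub>R phi (N2 p) + phi (n1_mat p v))) (base_pt p) = 0"
      by (rule gen_centralizer)
    then show ?thesis unfolding comb o'_def linear_add[OF linear_gen, of _ "a *\<^sub>R Hr + _"] gen_sol by simp
  qed
  have gen_T: "gen (T (n1_mat p v)) o' = ?Z 0 0 v" for v using gen_comb[of 0 0 v] by simp

  \<comment> \<open>The \<open>p\<close>-component of v is invisible to \<open>n1_mat\<close>, so
    uniqueness is claimed for the matrix and not for v.\<close>
  have comb_inject: "a = a' \<and> e = e' \<and> n1_mat p v = n1_mat p v'" if "?comb a e v = ?comb a' e' v'" for a e v a' e' v'
    using tangent_vec_inject[of p a e v a' e' v'] arg_cong[OF that, of "\<lambda>X. gen X o'"]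
    unfolding gen_comb by blast
  have coords: "alpha_of p T (?comb a e v) = a" "eta_of p T (?comb a e v) = e"
    "X_of p T (?comb a e v) = n1_mat p v" for a e v
  proof -
    show "alpha_of p T (?comb a e v) = a" unfolding alpha_of_def nil1_def
      by (rule the_equality) (use comb_inject in blast)+
    show "eta_of p T (?comb a e v) = e" unfolding eta_of_def nil1_def
      by (rule the_equality) (use comb_inject in blast)+
    show "X_of p T (?comb a e v) = n1_mat p v" unfolding X_of_def nil1_def
    proof (rule the_equality)
      fix X assume "X \<in> range (n1_mat p) \<and> (\<exists>a' e'. ?comb a e v = a' *\<^sub>R T (A0 p) + e' *\<^sub>R T (N2 p) + T X)"
      then obtain a' e' v' where "X = n1_mat p v'" "?comb a e v = ?comb a' e' v'" by blast
      with comb_inject show "X = n1_mat p v" by metis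
    qed blast
  qed
  have J: "J_o \<mu> p \<mm> (?comb a e v) = ?comb (e / 2) (- 2 * a) (\<i> *s v)" for a e v
    unfolding J_o_def
  proof (rule the_equality)
    let ?E = "?comb (e / 2) (- 2 * a) (\<i> *s v)"
    have E: "gen ?E o' = \<i> *s gen (?comb a e v) o'" unfolding gen_comb i_tangent_vec ..
    have om: "omega_o \<mu> p X (?comb a e v) = g_o \<mu> p X ?E" for X
      unfolding omega_o_def g_o_def CH_kaehler_def o'_def[symmetric] E ..
    then show "?E \<in> \<mm> \<and> (\<forall>B\<in>\<mm>. omega_o \<mu> p B (?comb a e v) = g_o \<mu> p B ?E)"
      using T_in by blast
    fix F assume F: "F \<in> \<mm> \<and> (\<forall>B\<in>\<mm>. omega_o \<mu> p B (?comb a e v) = g_o \<mu> p B F)"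
    then obtain a' e' v' where F': "F = ?comb a' e' v'" using \<mm>_cases by blast
    let ?d = "gen F o' - gen ?E o'"
    have eq: "g (gen X o') (gen F o') = g (gen X o') (gen ?E o')" if "X \<in> \<mm>" for X
      using F that om[of X] by (auto simp: g_o_def o'_def g_def)
    \<comment> \<open>The difference of two candidates for J is itself in \<mm>, so it may be used
      as the test vector; its velocity then has length zero.\<close>
    have "F - ?E \<in> \<mm>" using F T_in subspace_diff[OF sub(2)] by blast
    from eq[OF this] have "g (gen F o') ?d = g (gen ?E o') ?d"
      unfolding linear_diff[OF linear_gen] g_def o'_def by (metis CH_metric_base_pt_sym)
    moreover have "g ?d ?d = g (gen F o') ?d - g (gen ?E o') ?d"
      unfolding g_def o'_def by (rule linear_diff[OF linear_CH_metric_base_pt])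
    ultimately have "g ?d ?d = 0" by (simp only: diff_self)
    then have "?d = 0" using CH_metric_base_pt_eq_0[OF mu] unfolding g_def o'_def by blast
    then have "?Z a' e' v' = ?Z (e / 2) (- 2 * a) (\<i> *s v)" unfolding F' gen_comb by simp
    from tangent_vec_inject[OF this] show "F = ?E" unfolding F' by (simp only:)
  qed

  \<comment> \<open>Both connections at the base point and the assembly of S\<close>
  obtain aB eB vB where B: "B = ?comb aB eB vB" using \<mm>_cases BCD(1) by blast
  obtain aC eC vC where C: "C = ?comb aC eC vC" using \<mm>_cases BCD(2) by blast
  obtain aD eD vD where D: "D = ?comb aD eD vD" using \<mm>_cases BCD(3) by blast
  define b c d where "b = gen B o'" and "c = gen C o'" and "d = gen D o'"
  have bcd: "b = ?Z aB eB vB" "c = ?Z aC eC vC" "d = ?Z aD eD vD"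
    unfolding b_def c_def d_def B C D by (rule gen_comb)+
  define B' where "B' = aB *\<^sub>R phi (A0 p) + eB *\<^sub>R phi (N2 p) + phi (n1_mat p vB)"
  have B'_cent: "B' \<in> centralizer {A0 p, N2 p}" unfolding B'_def using iso \<hh>_cent by blast

  have aff: "affine_connection (CH p) nabla" "affine_connection (CH p) nabla'"
    using nabla nabla' by (auto simp: levi_civita_def canonical_connection_def)
  have "nabla V W o' = dir_deriv V W o' + nabla (\<lambda>_. b) (\<lambda>_. c) o'"
    "nabla' V W o' = dir_deriv V W o' + nabla' (\<lambda>_. b) (\<lambda>_. c) o'"
    using connection_christoffel[OF aff(1) open_CH base_pt_in_CH VW(1,3)]
      connection_christoffel[OF aff(2) open_CH base_pt_in_CH VW(1,3)]
    by (simp_all add: VW(2,4) o'_def b_def c_def)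
  moreover have "nabla' (\<lambda>_. b) (\<lambda>_. c) o' = - gen_deriv B o' c"
  proof -
    have "nabla' (gen B) (gen C) o' = dir_deriv (gen B) (gen C) o' + nabla' (\<lambda>_. b) (\<lambda>_. c) o'"
      using connection_christoffel[OF aff(2) open_CH base_pt_in_CH smooth_on_gen[OF open_CH] smooth_on_gen[OF open_CH]]
      by (simp add: o'_def b_def c_def)
    moreover have "dir_deriv (gen B) (gen C) o' = gen_deriv C o' b"
      unfolding dir_deriv_def b_def by (simp add: frechet_derivative_at[OF gen_has_derivative, symmetric])
    moreover have "nabla' (gen B) (gen C) o' = - gen (comm B C) o'"
      using nabla' BCD(1,2) gen_m_part[OF m comm_in_lie_algebra[OF Fr m Hr phir(2,3) BCD(1,2)]]
      by (simp add: canonical_connection_def o'_def)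
    ultimately show ?thesis unfolding gen_comm b_def c_def by (simp add: algebra_simps eq_neg_iff_add_eq_0)
  qed
  ultimately have S: "nabla V W o' - nabla' V W o' = nabla (\<lambda>_. b) (\<lambda>_. c) o' + gen_deriv B o' c" by simp
  have LC: "g (nabla (\<lambda>_. b) (\<lambda>_. c) o') d = g (christoffel p b c) d"
    unfolding g_def o'_def
    by (rule levi_civita_christoffel[OF nabla open_CH base_pt_in_CH linear_CH_metric_base_pt
          CH_metric_base_pt_sym _ CH_metric_has_derivative]) (simp add: christoffel_def add.commute)
  have gen_deriv_B: "gen_deriv B o' c
      = gen_deriv (aB *\<^sub>R A0 p + eB *\<^sub>R N2 p + n1_mat p vB) o' c + (aB *\<^sub>R gen_deriv Hr o' c + gen_deriv B' o' c)"
    unfolding B comb B'_def[symmetric]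
    by (simp only: linear_add[OF linear_gen_deriv] linear_scale[OF linear_gen_deriv])
  have g_B': "g_o \<mu> p (comm B' C) D = g (gen_deriv B' o' c) d"
    unfolding g_o_def gen_comm gen_centralizer[OF B'_cent] gen_deriv_0 g_def o'_def c_def d_def by simp
  \<comment> \<open>The bracket with \<open>Hr\<close> involves only X_C, whereas the derivative is
    taken along all of c. They agree because the isotropy action ignores the A_0- and N_2-parts of
    c; the summand that \<open>T\<close> adds through \<open>phi\<close> has velocity zero.\<close>
  have g_Hr: "g_o \<mu> p (T (comm Hr (n1_mat p vC))) D = g (gen_deriv Hr o' c) d"
  proof -
    have nil: "comm Hr (n1_mat p vC) \<in> nilp p"
      using comm_su_u1_nil1[OF Hr(1)] n1_mat_in_nilp by (metis nil1_def rangeE)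
    have "gen (phi (comm Hr (n1_mat p vC))) o' = 0"
      unfolding o'_def by (rule gen_centralizer[OF subsetD[OF \<hh>_cent phi_nilp_\<hh>[OF nil]]])
    moreover have "gen (n1_mat p vC) (base_pt p) = ?Z 0 0 vC" using gen_sol[of 0 p 0 vC] by simp
    moreover have "gen_deriv Hr o' (?Z 0 0 vC) = gen_deriv Hr o' c"
      unfolding o'_def gen_deriv_centralizer[OF Hr_cent] bcd
      by (auto simp: vec_eq_iff tangent_vec_def cong: sum.cong_simp)
    ultimately have "gen (T (comm Hr (n1_mat p vC))) o' = gen_deriv Hr o' c"
      unfolding T_nilp[OF nil] linear_add[OF linear_gen] gen_comm o'_def gen_centralizer[OF Hr_cent] gen_deriv_0
      by simp
    then show ?thesis by (simp add: g_o_def g_def o'_def d_def)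
  qed
  have g_lin: "g (x + y) w = g x w + g y w" "g (r *\<^sub>R x) w = r * g x w" for x y w r
    unfolding g_def o'_def
    by (rule linear_add[OF linear_CH_metric_base_pt],
        rule linear_scale[OF linear_CH_metric_base_pt, unfolded real_scaleR_def])
  have J_CD: "gen (J_o \<mu> p \<mm> C) o' = \<i> *s c" "gen (J_o \<mu> p \<mm> D) o' = \<i> *s d"
    unfolding C D J gen_comb bcd i_tangent_vec by (rule refl)+
  have coords_J: "alpha_of p T (J_o \<mu> p \<mm> B) = eB / 2" "alpha_of p T (J_o \<mu> p \<mm> C) = eC / 2"
    "alpha_of p T (J_o \<mu> p \<mm> D) = eD / 2"
    unfolding B C D J coords by (rule refl)+
  have coords_BCD: "alpha_of p T B = aB" "eta_of p T B = eB" "X_of p T B = n1_mat p vB"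
    "alpha_of p T C = aC" "X_of p T C = n1_mat p vC" "alpha_of p T D = aD" "X_of p T D = n1_mat p vD"
    unfolding B C D coords by (rule refl)+
  have g_o: "g_o \<mu> p B C = g b c" "g_o \<mu> p B D = g b d"
    "g_o \<mu> p B (J_o \<mu> p \<mm> C) = g b (\<i> *s c)" "g_o \<mu> p B (J_o \<mu> p \<mm> D) = g b (\<i> *s d)"
    "omega_o \<mu> p (T (n1_mat p vC)) (T (n1_mat p vD)) = g (?Z 0 0 vC) (\<i> *s ?Z 0 0 vD)"
    unfolding g_o_def omega_o_def CH_kaehler_def o'_def[symmetric] gen_T J_CD g_def b_def c_def d_def
    by (rule refl)+
  have "g (nabla V W o' - nabla' V W o') d
      = (g (christoffel p b c) d + g (gen_deriv (aB *\<^sub>R A0 p + eB *\<^sub>R N2 p + n1_mat p vB) o' c) d)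
        + g_o \<mu> p (comm B' C) D + aB * g_o \<mu> p (T (comm Hr (n1_mat p vC))) D"
    unfolding S gen_deriv_B g_lin LC g_B' g_Hr by simp
  also have "g (christoffel p b c) d + g (gen_deriv (aB *\<^sub>R A0 p + eB *\<^sub>R N2 p + n1_mat p vB) o' c) d
      = aD * g b c - aC * g b d + eD / 2 * g b (\<i> *s c) - eC / 2 * g b (\<i> *s d)
        - eB / 2 * g (?Z 0 0 vC) (\<i> *s ?Z 0 0 vD)"
    unfolding g_def o'_def by (rule structure_tensor_identity[OF bcd])
  finally show ?thesis
    unfolding Let_def phi_def[symmetric] T_def[symmetric] T_apply coords_J coords_BCD g_o B'_def[symmetric]
      o'_def[symmetric] g_def[symmetric] d_def[symmetric] .
qed

end
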